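(* Let $G$ be a countable (infinite, discrete) amenable group, let $(X,\sigma)$ be a $G$-subshift over a finite alphabet $\Lambda$, and let $\bm{\mathsf T}=\bigvee_{k\in\mathbb N}\mathsf T_k$ be a F{\o}lner, deterministic system of dynamical tilings of $G$, with $\mathcal S_k$ denoting the collection of shapes of $\mathsf T_k$. Let $\mathcal U\supset\mathcal M^{\mathsf{erg}}_\sigma(X)$ be an open set in $\mathcal B^*(X)\cup\mathcal M(X)$ (with the pseudometric $d^*$) and let $m\in\mathbb N$. Then for every $\varepsilon>0$ there exists $n\ge m$ such that for every $x\in X$ there exists a collection $\mathcal Q$ of pairwise disjoint sets (tiles) of the form $Q=Sc$ with $S\in\bigcup_{k=m}^n\mathcal S_k$ and $c\in G$, each of which is $\mathcal U$-ergodic (i.e. $x|_Q\in\mathcal U$), such that $\bigcup_{Q\in\mathcal Q}Q$ has lower Banach density in $G$ at least $1-\varepsilon$.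
   Context: F{\o}lner notions. A finite set $F\subset G$ (nonempty) is $(K,\delta)$-invariant, for finite $K\subset G$ and $\delta>0$, if $|F\triangle KF|/|F|<\delta$. A F{\o}lner sequence is a sequence of finite sets which, for every finite $K$ and $\delta>0$, are eventually $(K,\delta)$-invariant. $G$ is amenable if it has a F{\o}lner sequence. Lower Banach density of $A\subset G$: $\underline d_{\mathsf{Ban}}(A)=\sup_{F}\inf_{g\in G}\frac{|A\cap Fg|}{|F|}$, $F$ ranging over nonempty finite subsets of $G$. $G$-subshifts. $G$ acts on $\Lambda^G$ by $(g(x))(h)=x(hg)$; a $G$-subshift is a closed invariant $X\subset\Lambda^G$ with this action $\sigma$. A block with (finite, nonempty) domain $F\subset G$ is an element of $\Lambda^F$. For $C\in\Lambda^K$, $C'\in\Lambda^{Kg}$ write $C\approx C'$ if $C(k)=C'(kg)$ for all $k\in K$; $C$ occurs in $x$ if $x|_{Kg}\approx C$ for some $g\in G$. $\mathcal B^*(X)$ is the set of all finite blocks occurring in elements of $X$. The $K$-core of $F$ is $F_K=\{g\in F: Kg\subset F\}$. For $C\in\Lambda^K$, $B\in\Lambda^F$, $\mathrm{Fr}_B(C)=\frac{|\{g\in F_K: B|_{Kg}\approx C\}|}{|F|}$. $\mathcal M(X)$ = Borel probability measures on $X$, $\mathcal M_\sigma(X)$ = invariant ones, $\mathcal M_\sigma^{\mathsf{erg}}(X)$ = ergodic ones. For $C\in\Lambda^K$, $[C]=\{x\in X:x|_K=C\}$. Fix an enumeration $(K_l)_{l\in\mathbb N}$ of all finite subsets of $G$.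 For $p\in\mathcal B^*(X)\cup\mathcal M(X)$ put $p(C)=\mathrm{Fr}_p(C)$ if $p$ is a block and $p(C)=p([C])$ if $p$ is a measure; the pseudometric is $d^*(p,q)=\sum_{l=1}^\infty\frac{2^{-l}}{|K_l|+1}\sum_{C\in\Lambda^{K_l}}|p(C)-q(C)|$. Tilings. A tiling $\mathcal T$ of $G$ is a partition of $G$ into finite sets (tiles) for which there is a finite collection $\mathcal S$ of finite sets (shapes), each containing the unit $e$ (shapes in the collection need not all be different), such that each tile is $T=Sc$ for some $S\in\mathcal S$, $c\in T$. For each tile one such pair is chosen; $S$ is its shape and $c$ its center. $\mathcal T$ is identified with the element of $V^G$, $V=\{``S":S\in\mathcal S\}\cup\{``0"\}$, with $\mathcal T(g)=``S"$ if $g$ is the center of a tile of shape $S$, and $\mathcal T(g)=``0"$ otherwise. A dynamical tiling (with collection of shapes $\mathcal S$) is a nonempty closed shift-invariant set $\mathsf T\subset V^G$ consisting of tilings. A system of dynamical tilings $\bm{\mathsf T}=\bigvee_k\mathsf T_k$ is a topological joining of dynamical tilings $\mathsf T_k$ ($k\in\mathbb N$), i.e. a nonempty closed subset of $\prod_k\mathsf T_k$ invariant under the coordinatewise shift action. Let $\mathcal S_k$ be the collection of shapes of $\mathsf T_k$. The system is F{\o}lner if the shapes of all the $\mathcal S_k$, $k\in\mathbb N$, arranged in a sequence, form a F{\o}lner sequence (so for every finite $K$ and $\delta>0$ there is $k_0$ such that all $S\in\mathcal S_k$, $k\ge k_0$, are $(K,\delta)$-invariant). It is congruent if for each $(\mathcal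 T_k)_k\in\bm{\mathsf T}$ and each $k$, every tile of $\mathcal T_{k+1}$ is a union of tiles of $\mathcal T_k$. It is deterministic if it is congruent and for every $k$ and $S'\in\mathcal S_{k+1}$ there are sets $C_S(S')\subset G$, $S\in\mathcal S_k$, with $S'=\bigcup_{S\in\mathcal S_k}\bigcup_{c\in C_S(S')}Sc$, such that for each $(\mathcal T_l)_l\in\bm{\mathsf T}$, whenever $S'c'$ is a tile of $\mathcal T_{k+1}$, then $Scc'$ is a tile of $\mathcal T_k$ for every $S\in\mathcal S_k$ and $c\in C_S(S')$. *)

theory Defs
  imports "HOL-Probability.Probability" "HOL-Library.Set_Algebras"
begin

text \<open>
  The group is a type of class \<open>group_add\<close>, which is not assumed commutative: the product
  \<open>gh\<close> is written \<open>g + h\<close>, the unit \<open>e\<close> is \<open>0\<close>.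
\<close>

definition rtrans :: "'g::group_add set \<Rightarrow> 'g \<Rightarrow> 'g set" where
  "rtrans F c = (\<lambda>f. f + c) ` F"

subsection \<open>Folner notions\<close>

text \<open>\<open>K + F\<close> is the elementwise product \<open>KF\<close>.\<close>

definition invariant_set :: "'g::group_add set \<Rightarrow> real \<Rightarrow> 'g set \<Rightarrow> bool" where
  "invariant_set K \<delta> F \<longleftrightarrow>
     finite F \<and> F \<noteq> {} \<and> real (card ((F - (K + F)) \<union> ((K + F) - F))) / real (card F) < \<delta>"

text \<open>
  \<open>K\<close> has to be nonempty: for \<open>K = {}\<close> the quotient above is always \<open>1\<close>,
  so no sequence would be eventually invariant.
\<close>

definition folner_sequence :: "(nat \<Rightarrow> 'g::group_add set) \<Rightarrow> bool" where
  "folner_sequence F \<longleftrightarrow>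
     (\<forall>n. finite (F n)) \<and>
     (\<forall>K \<delta>. finite K \<longrightarrow> K \<noteq> {} \<longrightarrow> 0 < \<delta> \<longrightarrow> (\<forall>\<^sub>F n in sequentially. invariant_set K \<delta> (F n)))"

definition amenable :: "'g::group_add itself \<Rightarrow> bool" where
  "amenable _ \<longleftrightarrow> (\<exists>F :: nat \<Rightarrow> 'g set. folner_sequence F)"

definition lower_banach_density :: "'g::group_add set \<Rightarrow> real" where
  "lower_banach_density A =
     (SUP F \<in> {F. finite F \<and> F \<noteq> {}}. INF g. real (card (A \<inter> rtrans F g)) / real (card F))"

subsection \<open>Subshifts, blocks and measures\<close>

definition shift :: "'g::group_add \<Rightarrow> ('g \<Rightarrow> 'b) \<Rightarrow> ('g \<Rightarrow> 'b)" where
  "shift g x = (\<lambda>h. x (h + g))"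

text \<open>\<open>closed\<close> refers to the product topology on the function type, over the discrete alphabet.\<close>

definition subshift :: "('g::group_add \<Rightarrow> 'a::{finite,discrete_topology}) set \<Rightarrow> bool" where
  "subshift X \<longleftrightarrow> closed X \<and> (\<forall>g. shift g ` X \<subseteq> X)"

text \<open>A block with domain \<open>F\<close> is a partial map \<open>B\<close> with \<open>dom B = F\<close>.\<close>

type_synonym ('g, 'a) block = "'g \<Rightarrow> 'a option"

definition restr :: "('g \<Rightarrow> 'a) \<Rightarrow> 'g set \<Rightarrow> ('g, 'a) block" where
  "restr x F = (\<lambda>g. Some (x g)) |` F"

text \<open>\<open>similar C g C'\<close>: \<open>C'\<close> has domain \<open>(dom C)g\<close> and is a translated copy of \<open>C\<close>.\<close>

definition similar :: "('g::group_add, 'a) block \<Rightarrow> 'g \<Rightarrow> ('g, 'a) block \<Rightarrow> bool" where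
  "similar C g C' \<longleftrightarrow> dom C' = rtrans (dom C) g \<and> (\<forall>k \<in> dom C. C k = C' (k + g))"

definition occurs :: "('g::group_add, 'a) block \<Rightarrow> ('g \<Rightarrow> 'a) \<Rightarrow> bool" where
  "occurs C x \<longleftrightarrow> (\<exists>g. similar C g (restr x (rtrans (dom C) g)))"

definition blocks :: "('g::group_add \<Rightarrow> 'a) set \<Rightarrow> ('g, 'a) block set" where
  "blocks X = {C. finite (dom C) \<and> dom C \<noteq> {} \<and> (\<exists>x\<in>X. occurs C x)}"

definition core :: "'g::group_add set \<Rightarrow> 'g set \<Rightarrow> 'g set" where
  "core K F = {g \<in> F. rtrans K g \<subseteq> F}"

definition Fr :: "('g::group_add, 'a) block \<Rightarrow> ('g, 'a) block \<Rightarrow> real" where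
  "Fr B C =
     real (card {g \<in> core (dom C) (dom B). similar C g (B |` rtrans (dom C) g)}) / real (card (dom B))"

definition prob_measures ::
  "('g::group_add \<Rightarrow> 'a::{finite,discrete_topology}) set \<Rightarrow> ('g \<Rightarrow> 'a) measure set" where
  "prob_measures X = {\<mu>. prob_space \<mu> \<and> sets \<mu> = sets (restrict_space borel X)}"

definition invariant_measures ::
  "('g::group_add \<Rightarrow> 'a::{finite,discrete_topology}) set \<Rightarrow> ('g \<Rightarrow> 'a) measure set" where
  "invariant_measures X =
     {\<mu> \<in> prob_measures X. \<forall>g. \<forall>A \<in> sets \<mu>. measure \<mu> (shift g -` A \<inter> X) = measure \<mu> A}"

definition ergodic_measures ::
  "('g::group_add \<Rightarrow> 'a::{finite,discrete_topology}) set \<Rightarrow> ('g \<Rightarrow> 'a) measure set" where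
  "ergodic_measures X =
     {\<mu> \<in> invariant_measures X.
        \<forall>A \<in> sets \<mu>. (\<forall>g. shift g -` A \<inter> X = A) \<longrightarrow> measure \<mu> A = 0 \<or> measure \<mu> A = 1}"

definition cylinder :: "('g \<Rightarrow> 'a) set \<Rightarrow> ('g, 'a) block \<Rightarrow> ('g \<Rightarrow> 'a) set" where
  "cylinder X C = {x \<in> X. restr x (dom C) = C}"

text \<open>The union of the finite blocks and the probability measures is formed as a disjoint sum.\<close>

type_synonym ('g, 'a) block_or_measure = "('g, 'a) block + ('g \<Rightarrow> 'a) measure"

definition blocks_measures ::
  "('g::group_add \<Rightarrow> 'a::{finite,discrete_topology}) set \<Rightarrow> ('g, 'a) block_or_measure set" where
  "blocks_measures X = blocks X <+> prob_measures X"

definition freq ::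
  "('g::group_add \<Rightarrow> 'a) set \<Rightarrow> ('g, 'a) block_or_measure \<Rightarrow> ('g, 'a) block \<Rightarrow> real" where
  "freq X p C = (case p of Inl B \<Rightarrow> Fr B C | Inr \<mu> \<Rightarrow> measure \<mu> (cylinder X C))"

text \<open>
  \<open>K\<close> is the chosen enumeration of the finite subsets of the group; it starts at index \<open>0\<close>
  instead of \<open>1\<close>, whence the exponent \<open>Suc l\<close>.
\<close>

definition dstar ::
  "(nat \<Rightarrow> 'g::group_add set) \<Rightarrow> ('g \<Rightarrow> 'a::finite) set
     \<Rightarrow> ('g, 'a) block_or_measure \<Rightarrow> ('g, 'a) block_or_measure \<Rightarrow> real" where
  "dstar K X p q =
     (\<Sum>l. (1 / 2) ^ Suc l / (real (card (K l)) + 1) *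
           (\<Sum>C | dom C = K l. \<bar>freq X p C - freq X q C\<bar>))"

definition dstar_open ::
  "(nat \<Rightarrow> 'g::group_add set) \<Rightarrow> ('g \<Rightarrow> 'a::{finite,discrete_topology}) set
     \<Rightarrow> ('g, 'a) block_or_measure set \<Rightarrow> bool" where
  "dstar_open K X U \<longleftrightarrow>
     U \<subseteq> blocks_measures X \<and>
     (\<forall>p\<in>U. \<exists>r>0. \<forall>q \<in> blocks_measures X. dstar K X p q < r \<longrightarrow> q \<in> U)"

subsection \<open>Tilings\<close>

text \<open>
  A collection of shapes, with possible repetitions, is a list \<open>S\<close> of sets. Its positions
  \<open>i < length S\<close> are the labels of the shapes: the symbol of the shape at position \<open>i\<close> is
  \<open>Some i\<close>, the symbol ``0'' is \<open>None\<close>.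
\<close>

type_synonym 'g tiling = "'g \<Rightarrow> nat option"

definition shape_collection :: "'g::group_add set list \<Rightarrow> bool" where
  "shape_collection S \<longleftrightarrow> (\<forall>F \<in> set S. finite F \<and> 0 \<in> F)"

definition symbols :: "'g set list \<Rightarrow> nat option set" where
  "symbols S = insert None (Some ` {..<length S})"

text \<open>The tile of \<open>T\<close> with center \<open>c\<close>, meaningful for \<open>c \<in> dom T\<close>.\<close>

definition tile :: "'g::group_add set list \<Rightarrow> 'g tiling \<Rightarrow> 'g \<Rightarrow> 'g set" where
  "tile S T c = rtrans (S ! the (T c)) c"

definition tiles :: "'g::group_add set list \<Rightarrow> 'g tiling \<Rightarrow> 'g set set" where
  "tiles S T = tile S T ` dom T"

text \<open>Injectivity says that only one pair of a shape and a center is chosen for each tile.\<close>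

definition is_tiling :: "'g::group_add set list \<Rightarrow> 'g tiling \<Rightarrow> bool" where
  "is_tiling S T \<longleftrightarrow>
     range T \<subseteq> symbols S \<and> partition_on UNIV (tiles S T) \<and> inj_on (tile S T) (dom T)"

definition dynamical_tiling :: "'g::group_add set list \<Rightarrow> 'g tiling set \<Rightarrow> bool" where
  "dynamical_tiling S TT \<longleftrightarrow>
     shape_collection S \<and> TT \<noteq> {} \<and>
     closedin (product_topology (\<lambda>_. discrete_topology (symbols S)) UNIV) TT \<and>
     (\<forall>g. shift g ` TT \<subseteq> TT) \<and>
     (\<forall>T\<in>TT. is_tiling S T)"

text \<open>
  In the following, \<open>S k\<close> is the collection of shapes of the dynamical tiling \<open>TT k\<close>, and
  \<open>W\<close> is the joining, whose elements are sequences of tilings.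
\<close>

definition tiling_system ::
  "(nat \<Rightarrow> 'g::group_add set list) \<Rightarrow> (nat \<Rightarrow> 'g tiling set) \<Rightarrow> (nat \<Rightarrow> 'g tiling) set \<Rightarrow> bool" where
  "tiling_system S TT W \<longleftrightarrow>
     (\<forall>k. dynamical_tiling (S k) (TT k)) \<and> W \<noteq> {} \<and>
     closedin
       (product_topology
          (\<lambda>k. subtopology (product_topology (\<lambda>_. discrete_topology (symbols (S k))) UNIV) (TT k))
          UNIV) W \<and>
     (\<forall>g. (\<lambda>T k. shift g (T k)) ` W \<subseteq> W)"

definition folner_system :: "(nat \<Rightarrow> 'g::group_add set list) \<Rightarrow> bool" where
  "folner_system S \<longleftrightarrow>
     (\<forall>K \<delta>. finite K \<longrightarrow> K \<noteq> {} \<longrightarrow> 0 < \<delta> \<longrightarrow>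
        (\<exists>k0. \<forall>k\<ge>k0. \<forall>F \<in> set (S k). invariant_set K \<delta> F))"

definition congruent_system ::
  "(nat \<Rightarrow> 'g::group_add set list) \<Rightarrow> (nat \<Rightarrow> 'g tiling) set \<Rightarrow> bool" where
  "congruent_system S W \<longleftrightarrow>
     (\<forall>T\<in>W. \<forall>k. \<forall>Q \<in> tiles (S (Suc k)) (T (Suc k)). \<exists>\<A> \<subseteq> tiles (S k) (T k). Q = \<Union>\<A>)"

text \<open>
  ``\<open>S'c'\<close> is a tile of \<open>T\<close>'' is read with its chosen shape and center, that is, \<open>T\<close> has the symbol
  of \<open>S'\<close> at \<open>c'\<close>.
\<close>

definition deterministic_system ::
  "(nat \<Rightarrow> 'g::group_add set list) \<Rightarrow> (nat \<Rightarrow> 'g tiling) set \<Rightarrow> bool" where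
  "deterministic_system S W \<longleftrightarrow>
     congruent_system S W \<and>
     (\<forall>k. \<forall>i' < length (S (Suc k)). \<exists>C :: nat \<Rightarrow> 'g set.
        S (Suc k) ! i' = (\<Union>i<length (S k). \<Union>c \<in> C i. rtrans (S k ! i) c) \<and>
        (\<forall>T\<in>W. \<forall>c'. T (Suc k) c' = Some i' \<longrightarrow>
           (\<forall>i<length (S k). \<forall>c \<in> C i. T k (c + c') = Some i)))"

end

theory Submission
  imports Defs
begin


text \<open>
  A point \<open>T\<close> of the tiling system is fixed. A state is an \<open>x \<in> X\<close> together with a tile \<open>Q\<close> of some level
  \<open>n\<close>. Its statistics are the proportion of \<open>Q\<close> that is not covered by good tiles of the levels
  \<open>m, \<dots>, n\<close>, followed by the frequencies in \<open>Q\<close> of visits of \<open>x\<close> to the clopen sets, enumerated as a sequence.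
  By congruence each statistic of \<open>Q\<close> is at most the average of its values over the tiles of a lower level
  contained in \<open>Q\<close>. Hence if the sequence of statistics is asymptotically maximal for the
  lexicographic order, then the same is true of most of these tiles.

  The limiting frequencies of such states form an invariant measure. It is ergodic: the set of visits to an invariant
  set would be nearly constant on each of the lower level tiles, so that visit frequencies would be
  close to \<open>0\<close> or \<open>1\<close> on most of them, instead of concentrating. Therefore the measure lies in \<open>\<U>\<close>, most tiles
  of a high level are good, and the maximal asymptotic uncovered proportion is \<open>0\<close>. The maximal good
  tiles then have the required density.
\<close>

section \<open>Averages over finite sets and over the cells of nested partitions\<close>

definition mean :: "'g set \<Rightarrow> ('g \<Rightarrow> real) \<Rightarrow> real" where
  "mean Q f = (\<Sum>h\<in>Q. f h) / real (card Q)"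

lemma mean_mono: "(\<And>h. h \<in> Q \<Longrightarrow> f h \<le> f' h) \<Longrightarrow> mean Q f \<le> mean Q f'"
  unfolding mean_def by (intro divide_right_mono sum_mono) auto

lemma mean_cong: "(\<And>h. h \<in> Q \<Longrightarrow> f h = f' h) \<Longrightarrow> mean Q f = mean Q f'"
  unfolding mean_def by (simp cong: sum.cong)

lemma mean_add: "mean Q (\<lambda>h. f h + f' h) = mean Q f + mean Q f'"
  unfolding mean_def by (simp add: sum.distrib add_divide_distrib)

lemma mean_diff: "mean Q (\<lambda>h. f h - f' h) = mean Q f - mean Q f'"
  unfolding mean_def by (simp add: sum_subtractf diff_divide_distrib)

lemma mean_cmult: "mean Q (\<lambda>h. c * f h) = c * mean Q f"
  unfolding mean_def by (simp add: sum_distrib_left)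

lemma mean_const: "finite Q \<Longrightarrow> Q \<noteq> {} \<Longrightarrow> mean Q (\<lambda>_. c) = c"
  unfolding mean_def by simp

lemma mean_nonneg: "(\<And>h. h \<in> Q \<Longrightarrow> 0 \<le> f h) \<Longrightarrow> 0 \<le> mean Q f"
  unfolding mean_def by (intro divide_nonneg_nonneg sum_nonneg) auto

lemma mean_le: "finite Q \<Longrightarrow> Q \<noteq> {} \<Longrightarrow> (\<And>h. h \<in> Q \<Longrightarrow> f h \<le> c) \<Longrightarrow> mean Q f \<le> c"
  using mean_mono[of Q f "\<lambda>_. c"] mean_const[of Q c] by simp

lemma mean_of_bool: "finite Q \<Longrightarrow> mean Q (\<lambda>h. of_bool (A h)) = real (card {h\<in>Q. A h}) / real (card Q)"
  unfolding mean_def by (simp add: Int_def)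

text \<open>\<open>P k g\<close> is the cell of the \<open>k\<close>-th partition that contains \<open>g\<close>.\<close>

locale nested_partitions =
  fixes P :: "nat \<Rightarrow> 'g \<Rightarrow> 'g set"
  assumes finite_part: "finite (P k g)"
    and self_in_part: "g \<in> P k g"
    and part_eq: "h \<in> P k g \<Longrightarrow> P k h = P k g"
    and part_Suc: "P k g \<subseteq> P (Suc k) g"
begin

lemma part_ne: "P k g \<noteq> {}"
  using self_in_part by auto

lemma part_mono: "q \<le> n \<Longrightarrow> P q g \<subseteq> P n g"
  by (induction rule: dec_induct) (use part_Suc in blast)+

lemma part_sym: "h \<in> P k g \<longleftrightarrow> g \<in> P k h"
  using part_eq self_in_part by metis

text \<open>Double counting: after the two sums are swapped, each \<open>u\<close> in
  \<open>I\<close> contributes \<open>f u / card (P q u)\<close> once for each of the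
  \<open>card (P q u)\<close> members of its own cell.\<close>

lemma sum_mean:
  assumes "finite I" and sub: "\<And>h. h \<in> I \<Longrightarrow> P q h \<subseteq> I"
  shows "(\<Sum>h\<in>I. mean (P q h) f) = sum f I"
proof -
  have extend: "(\<Sum>u\<in>P q h. F u) = (\<Sum>u\<in>I. if u \<in> P q h then F u else 0)"
    if "h \<in> I" for h and F :: "'g \<Rightarrow> real"
    by (rule sum.mono_neutral_cong_left) (use sub[OF that] assms(1) in auto)
  have "(\<Sum>h\<in>I. mean (P q h) f) = (\<Sum>h\<in>I. \<Sum>u\<in>P q h. f u / real (card (P q u)))"
    unfolding mean_def sum_divide_distrib
    by (intro sum.cong refl) (metis part_eq)
  also have "\<dots> = (\<Sum>h\<in>I. \<Sum>u\<in>I. if u \<in> P q h then f u / real (card (P q u)) else 0)"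
    by (intro sum.cong refl extend)
  also have "\<dots> = (\<Sum>u\<in>I. \<Sum>h\<in>I. if h \<in> P q u then f u / real (card (P q u)) else 0)"
    by (subst sum.swap) (simp add: part_sym)
  also have "\<dots> = (\<Sum>u\<in>I. \<Sum>h\<in>P q u. f u / real (card (P q u)))"
    by (intro sum.cong refl extend[symmetric])
  also have "\<dots> = sum f I"
    by (intro sum.cong refl) (simp add: finite_part part_ne)
  finally show ?thesis .
qed

lemma mean_mean:
  assumes "q \<le> n"
  shows "mean (P n g) (\<lambda>h. mean (P q h) f) = mean (P n g) f"
proof -
  have "P q h \<subseteq> P n g" if "h \<in> P n g" for h
    using part_mono[OF assms, of h] part_eq[OF that] by simp
  then show ?thesis
    unfolding mean_def[of "P n g"] using sum_mean[OF finite_part] by simp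
qed

end

section \<open>Lexicographically maximal statistics\<close>

text \<open>In \<open>f l x n h\<close> the index \<open>n\<close> is the level. Monotonicity in the
  level is what bounds the value of a cell by the average over its subcells.\<close>

locale lexicographic_maximum = nested_partitions P
  for P :: "nat \<Rightarrow> 'g \<Rightarrow> 'g set" +
  fixes X :: "'x set" and f :: "nat \<Rightarrow> 'x \<Rightarrow> nat \<Rightarrow> 'g \<Rightarrow> real"
  assumes X_ne: "X \<noteq> {}"
    and f_nonneg: "0 \<le> f l x n h" and f_le1: "f l x n h \<le> 1"
    and f_anti: "q \<le> n \<Longrightarrow> f l x n h \<le> f l x q h"
begin

fun val :: "nat \<Rightarrow> 'x \<times> nat \<times> 'g \<Rightarrow> real" where
  "val l (x, n, g) = mean (P n g) (f l x n)"

text \<open>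
  The states of \<open>near l n\<close> have level at least \<open>n\<close> and, up to \<open>1 / (n + 1)\<close>, lexicographically
  maximal values of the first \<open>l\<close> statistics.
\<close>

primrec near :: "nat \<Rightarrow> nat \<Rightarrow> ('x \<times> nat \<times> 'g) set" where
  "near 0 n = {(x, k, g). x \<in> X \<and> n \<le> k}"
| "near (Suc l) n = {v \<in> near l n. val l v > (INF j. SUP w\<in>near l j. val l w) - inverse (real (Suc n))}"

text \<open>Since \<open>near l j\<close> shrinks as \<open>j\<close> grows, this is the limit
  superior of statistic \<open>l\<close> over states of increasing level that are nearly maximal in
  the statistics before it.\<close>

definition maximum :: "nat \<Rightarrow> real" where
  "maximum l = (INF j. SUP w\<in>near l j. val l w)"

lemma near_Suc: "near (Suc l) n = {v \<in> near l n. val l v > maximum l - inverse (real (Suc n))}"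
  by (simp add: maximum_def)

declare near.simps(2) [simp del]

lemma value_nonneg: "0 \<le> val l v"
  by (cases v) (auto intro: mean_nonneg f_nonneg)

lemma value_le1: "val l v \<le> 1"
  by (cases v) (auto intro!: mean_le finite_part part_ne f_le1)

lemma near_anti: "n \<le> n' \<Longrightarrow> near l n' \<subseteq> near l n"
proof (induction l)
  case (Suc l)
  have "inverse (real (Suc n')) \<le> inverse (real (Suc n))" using Suc.prems by simp
  then have "maximum l - inverse (real (Suc n)) < r" if "maximum l - inverse (real (Suc n')) < r" for r
    using that by linarith
  then show ?case using Suc.IH[OF Suc.prems] unfolding near_Suc by blast
qed auto

lemma near_anti_left: "l \<le> l' \<Longrightarrow> near l' n \<subseteq> near l n"
  by (induction rule: dec_induct) (auto simp: near_Suc)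

lemma near_level: "(x, k, g) \<in> near l n \<Longrightarrow> x \<in> X \<and> n \<le> k"
  using near_anti_left[of 0 l n] by auto

lemma bdd_above_value: "bdd_above (val l ` A)"
  using value_le1 by (auto intro!: bdd_aboveI)

lemma sup_near_nonneg: "near l j \<noteq> {} \<Longrightarrow> 0 \<le> (SUP w\<in>near l j. val l w)"
  using value_nonneg bdd_above_value by (metis all_not_in_conv cSUP_upper2)

text \<open>The supremum over \<open>near l n\<close> is at least \<open>maximum l\<close>, so the
  positive slack leaves room for some state; this also keeps all suprema in the recursion over
  nonempty sets.\<close>

lemma near_ne: "near l n \<noteq> {}"
proof (induction l arbitrary: n)
  case 0
  then show ?case using X_ne by auto
next
  case (Suc l)
  have bdd: "bdd_below (range (\<lambda>j. SUP w\<in>near l j. val l w))"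
    using sup_near_nonneg Suc by (auto intro!: bdd_belowI[of _ 0])
  have "maximum l \<le> (SUP w\<in>near l n. val l w)"
    unfolding maximum_def by (rule cINF_lower[OF bdd]) simp
  moreover have "inverse (real (Suc n)) > 0" by simp
  ultimately have "maximum l - inverse (real (Suc n)) < (SUP w\<in>near l n. val l w)" by linarith
  then obtain w where "w \<in> near l n" "maximum l - inverse (real (Suc n)) < val l w"
    using less_cSUP_iff[OF Suc bdd_above_value] by blast
  then show ?case unfolding near_Suc by blast
qed

lemma maximum_nonneg: "0 \<le> maximum l"
  unfolding maximum_def by (rule cINF_greatest[OF UNIV_not_empty]) (rule sup_near_nonneg[OF near_ne])

lemma value_le_maximum:
  assumes "0 < \<delta>"
  obtains N where "N \<ge> p" "\<And>w. w \<in> near l N \<Longrightarrow> val l w < maximum l + \<delta>"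
proof -
  have bdd: "bdd_below (range (\<lambda>j. SUP w\<in>near l j. val l w))"
    using sup_near_nonneg near_ne by (auto intro!: bdd_belowI[of _ 0])
  have "(INF j. SUP w\<in>near l j. val l w) < maximum l + \<delta>"
    unfolding maximum_def using assms by simp
  then obtain j where j: "(SUP w\<in>near l j. val l w) < maximum l + \<delta>"
    using cINF_less_iff[OF _ bdd] by auto
  have "val l w < maximum l + \<delta>" if "w \<in> near l (max j p)" for w
  proof -
    have "w \<in> near l j" using that near_anti[of j "max j p" l] by auto
    then have "val l w \<le> (SUP w\<in>near l j. val l w)" by (rule cSUP_upper[OF _ bdd_above_value])
    then show ?thesis using j by simp
  qed
  then show ?thesis using that[of "max j p"] by auto
qed

text \<open>The upper bound already holds on \<open>near l N\<close> for large \<open>N\<close>; the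
  lower bound is the condition added in passing from \<open>l\<close> to
  \<open>Suc l\<close>.\<close>

lemma value_near_maximum:
  assumes "0 < \<delta>"
  obtains N where "N \<ge> p" "\<And>w. w \<in> near (Suc l) N \<Longrightarrow> \<bar>val l w - maximum l\<bar> < \<delta>"
proof -
  obtain N1 where N1: "N1 \<ge> p" "\<And>w. w \<in> near l N1 \<Longrightarrow> val l w < maximum l + \<delta>"
    using value_le_maximum[OF assms] by blast
  obtain N2 where N2: "inverse (real (Suc N2)) < \<delta>" using reals_Archimedean[OF assms] by blast
  let ?N = "max N1 N2"
  have "\<bar>val l w - maximum l\<bar> < \<delta>" if w: "w \<in> near (Suc l) ?N" for w
  proof -
    have "w \<in> near l N1" "w \<in> near (Suc l) N2"
      using w near_anti[of N1 ?N l] near_anti[of N2 ?N "Suc l"] by (auto simp: near_Suc)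
    then show ?thesis using N1(2)[of w] N2 by (auto simp: near_Suc)
  qed
  then show ?thesis using that[of ?N] N1 by auto
qed

text \<open>Passing to the lower level can only increase the statistic pointwise, and averaging
  first over subcells does not change the mean.\<close>

lemma value_le_mean_value:
  assumes "q \<le> n"
  shows "val l (x, n, g) \<le> mean (P n g) (\<lambda>h. val l (x, q, h))"
proof -
  have "val l (x, n, g) \<le> mean (P n g) (f l x q)"
    by (auto intro!: mean_mono f_anti assms)
  also have "\<dots> = mean (P n g) (\<lambda>h. val l (x, q, h))"
    by (simp add: mean_mean[OF assms])
  finally show ?thesis .
qed

text \<open>
  The values on the subcells of level \<open>q\<close> hardly exceed the maximum but have a mean close to it, so
  that most of them are close to it.
\<close>

lemma concentration:
  assumes "0 < \<epsilon>"
  shows "\<exists>q0. \<forall>q\<ge>q0. \<exists>N. \<forall>x n g. (x, n, g) \<in> near l N \<longrightarrow>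
           q \<le> n \<and> mean (P n g) (\<lambda>h. of_bool ((x, q, h) \<notin> near l p)) \<le> \<epsilon>"
  using assms
proof (induction l arbitrary: p \<epsilon>)
  case 0
  have "\<forall>x n g. (x, n, g) \<in> near 0 q \<longrightarrow>
      q \<le> n \<and> mean (P n g) (\<lambda>h. of_bool ((x, q, h) \<notin> near 0 p)) \<le> \<epsilon>" if "q \<ge> p" for q
    using that 0 by (auto simp: mean_def)
  then show ?case by blast
next
  case (Suc l)
  \<comment> \<open>The two kinds of bad subcells, \<open>B1\<close> and \<open>B2\<close> below,
    have proportions at most \<delta> and \<open>3 * real (Suc p) * \<delta>\<close>; this choice
    makes the total \<epsilon>.\<close>
  define \<delta> where "\<delta> = \<epsilon> / (3 * real (Suc p) + 1)"
  have \<delta>: "0 < \<delta>" "3 * real (Suc p) * \<delta> + \<delta> = \<epsilon>"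
  proof -
    have "0 < 3 * real (Suc p) + 1" by simp
    then show "0 < \<delta>" "3 * real (Suc p) * \<delta> + \<delta> = \<epsilon>"
      using Suc.prems mult_divide_mult_cancel_right[of "3 * real (Suc p) + 1" \<epsilon> 1]
        distrib_right[of "3 * real (Suc p)" 1 \<delta>]
      unfolding \<delta>_def by (auto simp: mult.commute)
  qed
  obtain p' where p': "p' \<ge> p" "\<And>w. w \<in> near l p' \<Longrightarrow> val l w < maximum l + \<delta>"
    using value_le_maximum[OF \<delta>(1)] by blast
  obtain q0 where q0: "\<And>q. q \<ge> q0 \<Longrightarrow> \<exists>N. \<forall>x n g. (x, n, g) \<in> near l N \<longrightarrow>
      q \<le> n \<and> mean (P n g) (\<lambda>h. of_bool ((x, q, h) \<notin> near l p')) \<le> \<delta>"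
    using Suc.IH[OF \<delta>(1)] by blast
  show ?case
  \<comment> \<open>The subcell level \<open>q\<close> is fixed first, and only then is the large
    state required to be near enough: \<open>N\<close> depends on \<open>q\<close>.\<close>
  proof (rule exI[of _ q0], intro allI impI)
    fix q assume "q \<ge> q0"
    then obtain N where N: "\<And>x n g. (x, n, g) \<in> near l N \<Longrightarrow>
      q \<le> n \<and> mean (P n g) (\<lambda>h. of_bool ((x, q, h) \<notin> near l p')) \<le> \<delta>"
      using q0 by blast
    obtain N2 where N2: "inverse (real (Suc N2)) < \<delta>" using reals_Archimedean[OF \<delta>(1)] by blast
    let ?N = "max N N2"
    have "q \<le> n \<and> mean (P n g) (\<lambda>h. of_bool ((x, q, h) \<notin> near (Suc l) p)) \<le> \<epsilon>"
      if v: "(x, n, g) \<in> near (Suc l) ?N" for x n g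
    proof -
      have v': "(x, n, g) \<in> near l N" "(x, n, g) \<in> near (Suc l) N2"
        using v near_anti[of N ?N l] near_anti[of N2 ?N "Suc l"] by (auto simp: near_Suc)
      \<comment> \<open>\<open>B1\<close> marks subcells that fail in an earlier statistic,
        \<open>B2\<close> those that pass there but whose statistic \<open>l\<close> is at least
        \<open>inverse (real (Suc p))\<close> below the maximum. As in Markov's inequality, the
        second kind must be rare because no subcell can compensate by much.\<close>
      define B1 B2 :: "'g \<Rightarrow> real"
        where "B1 = (\<lambda>h. of_bool ((x, q, h) \<notin> near l p'))"
          and "B2 = (\<lambda>h. of_bool ((x, q, h) \<in> near l p' \<and> (x, q, h) \<notin> near (Suc l) p))"
      have q: "q \<le> n" and B1: "mean (P n g) B1 \<le> \<delta>" using N[OF v'(1)] by (auto simp: B1_def)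
      have "maximum l - \<delta> \<le> val l (x, n, g)" using v'(2) N2 by (auto simp: near_Suc)
      also have "\<dots> \<le> mean (P n g) (\<lambda>h. val l (x, q, h))" by (rule value_le_mean_value[OF q])
      also have "\<dots> \<le> mean (P n g) (\<lambda>h. maximum l + \<delta> + B1 h - inverse (real (Suc p)) * B2 h)"
      proof (rule mean_mono)
        fix h assume "h \<in> P n g"
        show "val l (x, q, h) \<le> maximum l + \<delta> + B1 h - inverse (real (Suc p)) * B2 h"
        proof (cases "(x, q, h) \<in> near l p'")
          case True
          then have "(x, q, h) \<in> near l p" using near_anti[OF p'(1)] by auto
          then show ?thesis using True p'(2)[OF True] \<delta> by (auto simp: B1_def B2_def near_Suc)
        next
          case False
          \<comment> \<open>Here \<open>B1 h = 1\<close> and \<open>B2 h = 0\<close>, so the bound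
            follows from values being at most 1 and \<open>maximum l\<close> being
            nonnegative.\<close>
          then show ?thesis using value_le1[of l "(x, q, h)"] maximum_nonneg[of l] \<delta>
            by (auto simp: B1_def B2_def)
        qed
      qed
      also have "\<dots> = maximum l + \<delta> + mean (P n g) B1 - inverse (real (Suc p)) * mean (P n g) B2"
        by (simp add: mean_add mean_diff mean_cmult mean_const finite_part part_ne)
      finally have "inverse (real (Suc p)) * mean (P n g) B2 \<le> 3 * \<delta>" using B1 by linarith
      then have B2: "mean (P n g) B2 \<le> 3 * real (Suc p) * \<delta>" by (simp add: field_simps)
      have "mean (P n g) (\<lambda>h. of_bool ((x, q, h) \<notin> near (Suc l) p)) \<le> mean (P n g) (\<lambda>h. B1 h + B2 h)"
        by (rule mean_mono) (auto simp: B1_def B2_def)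
      also have "\<dots> \<le> \<epsilon>" using B1 B2 \<delta>(2) by (simp add: mean_add)
      finally show ?thesis using q by blast
    qed
    then show "\<exists>N. \<forall>x n g. (x, n, g) \<in> near (Suc l) N \<longrightarrow>
      q \<le> n \<and> mean (P n g) (\<lambda>h. of_bool ((x, q, h) \<notin> near (Suc l) p)) \<le> \<epsilon>" by blast
  qed
qed

end


section \<open>Finitary sets, and measures determined by them\<close>

text \<open>Over a finite alphabet these are the clopen subsets of the full shift.\<close>

definition finitary :: "('g \<Rightarrow> 'a) set \<Rightarrow> bool" where
  "finitary C \<longleftrightarrow> (\<exists>F. finite F \<and> (\<forall>x y. (\<forall>g\<in>F. x g = y g) \<longrightarrow> (x \<in> C \<longleftrightarrow> y \<in> C)))"

lemma finitaryI:
  "finite F \<Longrightarrow> (\<And>x y. (\<And>g. g \<in> F \<Longrightarrow> x g = y g) \<Longrightarrow> x \<in> C \<Longrightarrow> y \<in> C) \<Longrightarrow> finitary C"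
  unfolding finitary_def by metis

lemma finitary_UNIV [simp]: "finitary UNIV" and finitary_empty [simp]: "finitary {}"
  unfolding finitary_def by auto

lemma finitary_Compl: "finitary C \<Longrightarrow> finitary (- C)"
  unfolding finitary_def by auto

lemma finitary_Int: assumes "finitary C" "finitary D" shows "finitary (C \<inter> D)"
proof -
  obtain F F' where "finite F" "\<forall>x y. (\<forall>g\<in>F. x g = y g) \<longrightarrow> (x \<in> C \<longleftrightarrow> y \<in> C)"
    "finite F'" "\<forall>x y. (\<forall>g\<in>F'. x g = y g) \<longrightarrow> (x \<in> D \<longleftrightarrow> y \<in> D)"
    using assms unfolding finitary_def by blast
  then show ?thesis by (intro finitaryI[of "F \<union> F'"]) (simp, blast)
qed

lemma finitary_Un: "finitary C \<Longrightarrow> finitary D \<Longrightarrow> finitary (C \<union> D)"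
  using finitary_Compl[OF finitary_Int[OF finitary_Compl finitary_Compl]] by simp

lemma finitary_Diff: "finitary C \<Longrightarrow> finitary D \<Longrightarrow> finitary (C - D)"
  using finitary_Int[OF _ finitary_Compl] by (simp add: Diff_eq)

lemma finitary_UN: "finite I \<Longrightarrow> (\<And>i. i \<in> I \<Longrightarrow> finitary (C i)) \<Longrightarrow> finitary (\<Union>i\<in>I. C i)"
  by (induction rule: finite_induct) (auto intro: finitary_Un)

lemma finitary_INT: "finite I \<Longrightarrow> (\<And>i. i \<in> I \<Longrightarrow> finitary (C i)) \<Longrightarrow> finitary (\<Inter>i\<in>I. C i)"
  by (induction rule: finite_induct) (auto intro: finitary_Int)

lemma finitary_coordinate: "finitary {x. x g = a}"
  by (rule finitaryI[of "{g}"]) auto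

lemma finitary_shift:
  assumes "finitary C" shows "finitary (shift g -` C)"
proof -
  obtain F where F: "finite F" "\<And>x y. (\<forall>g\<in>F. x g = y g) \<Longrightarrow> (x \<in> C \<longleftrightarrow> y \<in> C)"
    using assms unfolding finitary_def by blast
  have "shift g y \<in> C" if "\<And>h. h \<in> (\<lambda>h. h + g) ` F \<Longrightarrow> x h = y h" "shift g x \<in> C" for x y
    using that F(2)[of "shift g x" "shift g y"] by (simp add: shift_def)
  then show ?thesis by (intro finitaryI[of "(\<lambda>h. h + g) ` F"]) (use F(1) in auto)
qed

lemma open_coordinate:
  fixes a :: "'a::discrete_topology"
  shows "open {x :: 'g \<Rightarrow> 'a. x g = a}"
proof -
  have cont: "continuous_on UNIV (\<lambda>x :: 'g \<Rightarrow> 'a. x g)" by (rule continuous_on_product_coordinates)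
  have "open ((\<lambda>x :: 'g \<Rightarrow> 'a. x g) -` {a})"
    by (rule open_vimage[OF _ cont]) (rule Topological_Spaces.open_discrete)
  then show ?thesis by (simp add: vimage_def)
qed

lemma finitary_open: fixes C :: "('g \<Rightarrow> 'a::{discrete_topology}) set" assumes "finitary C" shows "open C"
proof -
  obtain F where F: "finite F" "\<And>x y. (\<forall>g\<in>F. x g = y g) \<Longrightarrow> (x \<in> C \<longleftrightarrow> y \<in> C)"
    using assms unfolding finitary_def by blast
  show ?thesis
  proof (rule Topological_Spaces.openI)
    fix x assume "x \<in> C"
    then show "\<exists>T. open T \<and> x \<in> T \<and> T \<subseteq> C"
      by (intro exI[of _ "\<Inter>g\<in>F. {y. y g = x g}"]) (auto intro!: open_INT F(1) open_coordinate dest: F(2))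
  qed
qed

lemma finitary_closed: fixes C :: "('g \<Rightarrow> 'a::{discrete_topology}) set" shows "finitary C \<Longrightarrow> closed C"
  using finitary_open[OF finitary_Compl] by (simp add: closed_def)

lemma finitary_borel:
  "finitary C \<Longrightarrow> C \<in> sets (borel :: ('g \<Rightarrow> 'a::{discrete_topology}) measure)"
  by (rule borel_open[OF finitary_open])

lemma open_finitary_nhd:
  fixes U :: "('g \<Rightarrow> 'a::{discrete_topology}) set"
  assumes "open U" "x \<in> U"
  obtains C where "finitary C" "x \<in> C" "C \<subseteq> U"
proof -
  obtain Y where Y: "x \<in> Pi\<^sub>E UNIV Y" "\<And>i. open (Y i)" "finite {i. Y i \<noteq> UNIV}" "Pi\<^sub>E UNIV Y \<subseteq> U"
    using product_topology_open_contains_basis[of "\<lambda>_. euclidean" UNIV U x] assms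
    by (auto simp: euclidean_product_topology)
  have "finitary (\<Inter>i\<in>{i. Y i \<noteq> UNIV}. {y. y i = x i})"
    by (rule finitary_INT[OF Y(3) finitary_coordinate])
  moreover have "(\<Inter>i\<in>{i. Y i \<noteq> UNIV}. {y. y i = x i}) \<subseteq> Pi\<^sub>E UNIV Y"
    using Y(1) by (fastforce simp: PiE_iff)
  ultimately show ?thesis using that[of "\<Inter>i\<in>{i. Y i \<noteq> UNIV}. {y. y i = x i}"] Y(4) by auto
qed

text \<open>A finitary set is given by a finite window and a set of blocks on it; there are
  countably many windows and finitely many block sets for each.\<close>

lemma countable_finitary: "countable {C :: ('g::countable \<Rightarrow> 'a::finite) set. finitary C}"
proof -
  have "{C :: ('g \<Rightarrow> 'a) set. finitary C} \<subseteq>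
      (\<Union>F\<in>{F. finite F}. (\<lambda>\<B>. {x. restr x F \<in> \<B>}) ` Pow {B. dom B = F})"
  proof
    fix C :: "('g \<Rightarrow> 'a) set" assume "C \<in> {C. finitary C}"
    then obtain F where F: "finite F" "\<And>x y. (\<forall>g\<in>F. x g = y g) \<Longrightarrow> (x \<in> C \<longleftrightarrow> y \<in> C)"
      unfolding finitary_def by blast
    have "x \<in> C" if "y \<in> C" "restr x F = restr y F" for x y
    proof -
      have "x g = y g" if "g \<in> F" for g
        using fun_cong[OF \<open>restr x F = restr y F\<close>, of g] that by (simp add: restr_def)
      then show ?thesis using F(2) that(1) by blast
    qed
    then have "C = {x. restr x F \<in> (\<lambda>y. restr y F) ` C}" by auto
    moreover have "(\<lambda>y. restr y F) ` C \<in> Pow {B. dom B = F}" by (auto simp: restr_def restrict_map_def dom_def split: if_splits)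
    ultimately show "C \<in> (\<Union>F\<in>{F. finite F}. (\<lambda>\<B>. {x. restr x F \<in> \<B>}) ` Pow {B. dom B = F})"
      using F(1) by blast
  qed
  moreover have "finite {B :: ('g, 'a) block. dom B = F}" if "finite F" for F
    using finite_set_of_finite_maps[OF that, of "UNIV :: 'a set"] by simp
  then have "countable (\<Union>F\<in>{F::'g set. finite F}. (\<lambda>\<B>. {x::'g\<Rightarrow>'a. restr x F \<in> \<B>}) ` Pow {B. dom B = F})"
    by (intro countable_UN countable_Collect_finite) (simp add: countable_finite)
  ultimately show ?thesis by (rule countable_subset)
qed

lemma compact_UNIV_fun: "compact (UNIV :: ('g \<Rightarrow> 'a::{finite,topological_space}) set)"
proof -
  have "compact_space (product_topology (\<lambda>_::'g. euclidean :: 'a topology) UNIV)"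
    by (simp add: compact_space_product_topology) (simp add: compact_space_def finite_imp_compact)
  then show ?thesis by (simp add: euclidean_product_topology compact_space_def)
qed

text \<open>Finitary sets form a countable base of the topology, so each open set is a countable
  union of them.\<close>

lemma sigma_sets_finitary:
  "sigma_sets UNIV {C. finitary C} = sets (borel :: ('g::countable \<Rightarrow> 'a::{finite,discrete_topology}) measure)"
proof
  show "sigma_sets UNIV {C. finitary C} \<subseteq> sets (borel :: ('g \<Rightarrow> 'a) measure)"
    using sets.sigma_sets_subset[of "{C. finitary C}" "borel :: ('g \<Rightarrow> 'a) measure"] finitary_borel by auto
  have "U \<in> sigma_sets UNIV {C. finitary C}" if "open U" for U :: "('g \<Rightarrow> 'a) set"
  proof -
    have "U = \<Union>{C. finitary C \<and> C \<subseteq> U}" by (auto elim: open_finitary_nhd[OF that])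
    moreover have "countable {C. finitary C \<and> C \<subseteq> U}"
      by (rule countable_subset[OF _ countable_finitary]) auto
    ultimately show ?thesis
      using sigma_sets_UNION[of "{C. finitary C \<and> C \<subseteq> U}" UNIV "{C. finitary C}"] sigma_sets.Basic
      by auto
  qed
  then show "sets (borel :: ('g \<Rightarrow> 'a) measure) \<subseteq> sigma_sets UNIV {C. finitary C}"
    unfolding borel_def by (simp add: sets_measure_of_conv) (rule sigma_sets_mono, auto)
qed

text \<open>Finite additivity suffices for the Caratheodory extension: by compactness a decreasing
  sequence of finitary sets with empty intersection is eventually empty, which gives continuity at
  the empty set.\<close>

lemma finitary_measure_extension:
  fixes \<nu> :: "('g::countable \<Rightarrow> 'a::{finite,discrete_topology}) set \<Rightarrow> real"
  assumes nonneg: "\<And>C. finitary C \<Longrightarrow> 0 \<le> \<nu> C"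
    and additive: "\<And>C D. finitary C \<Longrightarrow> finitary D \<Longrightarrow> C \<inter> D = {} \<Longrightarrow> \<nu> (C \<union> D) = \<nu> C + \<nu> D"
    and UNIV: "\<nu> UNIV = 1"
  obtains \<mu> where "prob_space \<mu>" "sets \<mu> = sets borel" "\<And>C. finitary C \<Longrightarrow> measure \<mu> C = \<nu> C"
proof -
  let ?M = "{C :: ('g \<Rightarrow> 'a) set. finitary C}"
  interpret ring_of_sets UNIV ?M
    by (rule ring_of_setsI) (simp_all add: finitary_Un finitary_Diff)
  have empty: "\<nu> {} = 0" using additive[of "{}" "{}"] by simp
  have "\<exists>m :: ('g \<Rightarrow> 'a) set \<Rightarrow> ennreal. (\<forall>s\<in>?M. m s = ennreal (\<nu> s)) \<and> measure_space UNIV (sigma_sets UNIV ?M) m"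
  proof (rule caratheodory_empty_continuous)
    show "positive ?M (\<lambda>s. ennreal (\<nu> s))" using nonneg empty by (simp add: positive_def)
    show "additive ?M (\<lambda>s. ennreal (\<nu> s))"
      using additive nonneg by (auto simp: additive_def)
    fix A :: "nat \<Rightarrow> ('g \<Rightarrow> 'a) set" assume A: "range A \<subseteq> ?M" "decseq A" "(\<Inter>i. A i) = {}"
    have "\<exists>i. A i = {}"
    proof (rule ccontr)
      assume ne: "\<nexists>i. A i = {}"
      have "UNIV \<inter> (\<Inter>i\<in>UNIV. A i) \<noteq> {}"
      proof (rule compact_imp_fip_image[OF compact_UNIV_fun])
        show "closed (A i)" for i using A(1) by (auto intro: finitary_closed)
        fix I :: "nat set" assume I: "finite I"
        have "A (Max (insert 0 I)) \<subseteq> (\<Inter>i\<in>I. A i)"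
          by (intro INT_greatest decseqD[OF A(2)]) (use I in simp)
        then show "UNIV \<inter> (\<Inter>i\<in>I. A i) \<noteq> {}" using ne by blast
      qed
      with A(3) show False by simp
    qed
    then obtain i where i: "A i = {}" by blast
    have "A j = {}" if "j \<ge> i" for j using decseqD[OF A(2) that] i by simp
    then have "eventually (\<lambda>j. ennreal (\<nu> (A j)) = 0) sequentially"
      unfolding eventually_sequentially using empty by (intro exI[of _ i]) simp
    then show "(\<lambda>i. ennreal (\<nu> (A i))) \<longlonglongrightarrow> 0" by (rule tendsto_eventually)
  qed auto
  then obtain m :: "('g \<Rightarrow> 'a) set \<Rightarrow> ennreal"
    where m: "\<And>s. finitary s \<Longrightarrow> m s = ennreal (\<nu> s)" "measure_space UNIV (sets borel) m"
    unfolding sigma_sets_finitary by auto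
  define \<mu> where "\<mu> = measure_of UNIV (sets borel) m"
  have sets: "sets \<mu> = sets borel"
    using sets.sigma_sets_eq[of "borel :: ('g \<Rightarrow> 'a) measure"] by (simp add: \<mu>_def)
  have em: "emeasure \<mu> A = m A" if "A \<in> sets borel" for A
    using emeasure_measure_of_sigma[of UNIV "sets borel" m A] m(2) that
    by (simp add: \<mu>_def measure_space_def)
  have fin: "emeasure \<mu> C = ennreal (\<nu> C)" if "finitary C" for C
    using em[OF finitary_borel[OF that]] m(1)[OF that] by simp
  have "space \<mu> = UNIV" by (simp add: \<mu>_def space_measure_of_conv)
  then have "prob_space \<mu>" using fin[of UNIV] UNIV by (intro prob_spaceI) simp
  moreover have "measure \<mu> C = \<nu> C" if "finitary C" for C
    using fin[OF that] nonneg[OF that] by (simp add: measure_def)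
  ultimately show ?thesis using sets that by blast
qed

text \<open>Induction over the generation of the \<sigma>-algebra. A countable union is first
  truncated to finitely many members, at a loss below \<open>\<delta> / 2\<close>, and these are
  then approximated one by one.\<close>

lemma finitary_approximation:
  fixes \<mu> :: "('g::countable \<Rightarrow> 'a::{finite,discrete_topology}) measure"
  assumes "prob_space \<mu>" "sets \<mu> = sets borel" "A \<in> sets borel" "0 < \<delta>"
  obtains C where "finitary C" "measure \<mu> ((A - C) \<union> (C - A)) < \<delta>"
proof -
  interpret prob_space \<mu> by fact
  have fin_sets: "finitary C \<Longrightarrow> C \<in> sets \<mu>" for C
    using assms(2) finitary_borel by simp
  have "A \<in> sigma_sets UNIV {C. finitary C}" using assms(3) by (simp add: sigma_sets_finitary)
  then have "\<forall>\<delta>>0. \<exists>C. finitary C \<and> measure \<mu> ((A - C) \<union> (C - A)) < \<delta>"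
  proof (induction rule: sigma_sets.induct)
    case (Basic A)
    then show ?case by (intro allI impI exI[of _ A]) simp
  next
    case Empty
    then show ?case by (intro allI impI exI[of _ "{}"]) simp
  next
    case (Compl A)
    show ?case
    proof (intro allI impI)
      fix \<delta> :: real assume "0 < \<delta>"
      then obtain C where C: "finitary C" "measure \<mu> ((A - C) \<union> (C - A)) < \<delta>" using Compl.IH by blast
      have "(UNIV - A - (- C)) \<union> (- C - (UNIV - A)) = (A - C) \<union> (C - A)" by auto
      then show "\<exists>C. finitary C \<and> measure \<mu> ((UNIV - A - C) \<union> (C - (UNIV - A))) < \<delta>"
        using C finitary_Compl by (intro exI[of _ "- C"]) auto
    qed
  next
    case (Union A)
    have A: "A i \<in> sets \<mu>" for i using Union.hyps assms(2) by (simp add: sigma_sets_finitary)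
    show ?case
    proof (intro allI impI)
      fix \<delta> :: real assume \<delta>: "0 < \<delta>"
      let ?B = "\<lambda>n. \<Union>i<n. A i"
      have "(\<lambda>n. measure \<mu> (?B n)) \<longlonglongrightarrow> measure \<mu> (\<Union>n. ?B n)"
        by (rule finite_Lim_measure_incseq) (use A in \<open>auto simp: incseq_def, fastforce\<close>)
      moreover have "(\<Union>n. ?B n) = \<Union>(range A)" by auto
      ultimately have "eventually (\<lambda>n. dist (measure \<mu> (?B n)) (measure \<mu> (\<Union>(range A))) < \<delta> / 2) sequentially"
        using \<delta> by (auto dest!: tendstoD[of _ _ _ "\<delta> / 2"])
      then obtain n where n: "dist (measure \<mu> (?B n)) (measure \<mu> (\<Union>(range A))) < \<delta> / 2"
        by (meson eventually_happens sequentially_bot)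
      have diff: "measure \<mu> (\<Union>(range A) - ?B n) < \<delta> / 2"
        using abs_ge_minus_self[of "measure \<mu> (?B n) - measure \<mu> (\<Union>(range A))"] n A
        by (subst finite_measure_Diff) (auto simp: dist_real_def)
      \<comment> \<open>The error allowed for each of the \<open>n\<close> members; together they
        stay within \<open>\<delta> / 2\<close>, and \<open>Suc n\<close> avoids division by zero
        for \<open>n = 0\<close>.\<close>
      have "\<delta> / (2 * real (Suc n)) > 0" using \<delta> by simp
      then have "\<forall>i. \<exists>C. finitary C \<and> measure \<mu> ((A i - C) \<union> (C - A i)) < \<delta> / (2 * real (Suc n))"
        using Union.IH by blast
      then obtain C where C: "\<And>i. finitary (C i)"
        "\<And>i. measure \<mu> ((A i - C i) \<union> (C i - A i)) < \<delta> / (2 * real (Suc n))" by metis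
      let ?C = "\<Union>i<n. C i"
      let ?D = "\<lambda>i. (A i - C i) \<union> (C i - A i)"
      have D: "?D i \<in> sets \<mu>" for i using A fin_sets[OF C(1)] by auto
      have "measure \<mu> ((\<Union>(range A) - ?C) \<union> (?C - \<Union>(range A)))
          \<le> measure \<mu> ((\<Union>(range A) - ?B n) \<union> (\<Union>i<n. ?D i))"
        using A D by (intro finite_measure_mono) auto
      also have "\<dots> \<le> measure \<mu> (\<Union>(range A) - ?B n) + measure \<mu> (\<Union>i<n. ?D i)"
        using A D by (intro measure_Un_le) auto
      also have "measure \<mu> (\<Union>i<n. ?D i) \<le> (\<Sum>i<n. measure \<mu> (?D i))"
        using D by (intro measure_UNION_le) auto
      also have "\<dots> \<le> (\<Sum>i<n. \<delta> / (2 * real (Suc n)))"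
        using C(2) by (intro sum_mono) (simp add: less_imp_le)
      also have "\<dots> \<le> \<delta> / 2" using \<delta> by (simp add: field_simps)
      finally have "measure \<mu> ((\<Union>(range A) - ?C) \<union> (?C - \<Union>(range A))) < \<delta>" using diff by linarith
      then show "\<exists>C. finitary C \<and> measure \<mu> ((\<Union>(range A) - C) \<union> (C - \<Union>(range A))) < \<delta>"
        using C(1) by (intro exI[of _ ?C]) (auto intro: finitary_UN)
    qed
  qed
  then show ?thesis using assms(4) that by blast
qed


section \<open>Visit frequencies along cells\<close>

text \<open>The empirical measure of the orbit piece of \<open>x\<close> over \<open>Q\<close>,
  evaluated at \<open>C\<close>.\<close>

definition visits :: "('g::group_add \<Rightarrow> 'a) \<Rightarrow> 'g set \<Rightarrow> ('g \<Rightarrow> 'a) set \<Rightarrow> real" where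
  "visits x Q C = mean Q (\<lambda>h. of_bool (shift h x \<in> C))"

lemma shift_shift: "shift g (shift h x) = shift (g + h) x"
  by (simp add: shift_def add.assoc)

lemma visits_nonneg: "0 \<le> visits x Q C"
  unfolding visits_def by (rule mean_nonneg) simp

lemma visits_Un: "C \<inter> D = {} \<Longrightarrow> visits x Q (C \<union> D) = visits x Q C + visits x Q D"
  unfolding visits_def mean_add[symmetric] by (rule mean_cong) auto

lemma visits_le_Un: "C \<subseteq> D \<union> E \<Longrightarrow> visits x Q C \<le> visits x Q D + visits x Q E"
  unfolding visits_def mean_add[symmetric] by (rule mean_mono) auto

lemma abs_sum_diff_le_card:
  fixes \<phi> :: "'b \<Rightarrow> real"
  assumes "finite A" "finite B" "\<And>h. 0 \<le> \<phi> h" "\<And>h. \<phi> h \<le> 1"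
  shows "\<bar>sum \<phi> A - sum \<phi> B\<bar> \<le> real (card ((A - B) \<union> (B - A)))"
proof -
  have "sum \<phi> A - sum \<phi> B = sum \<phi> (A - B) - sum \<phi> (B - A)"
    using sum.Int_Diff[OF assms(1), of \<phi> B] sum.Int_Diff[OF assms(2), of \<phi> A]
    by (simp add: Int_commute)
  moreover have "0 \<le> sum \<phi> D \<and> sum \<phi> D \<le> real (card D)" for D
    using sum_bounded_above[of D \<phi> 1] assms(3,4) by (simp add: sum_nonneg)
  moreover have "real (card ((A - B) \<union> (B - A))) = real (card (A - B)) + real (card (B - A))"
    using assms(1,2) by (subst card_Un_disjoint) auto
  ultimately show ?thesis by (smt (verit))
qed

lemma (in prob_space) abs_measure_diff:
  assumes "A \<in> events" "B \<in> events"
  shows "\<bar>prob A - prob B\<bar> \<le> prob ((A - B) \<union> (B - A))"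
proof -
  have "prob A \<le> prob (B \<union> ((A - B) \<union> (B - A)))" "prob B \<le> prob (A \<union> ((A - B) \<union> (B - A)))"
    using assms by (intro finite_measure_mono; auto)+
  moreover have "prob (B \<union> ((A - B) \<union> (B - A))) \<le> prob B + prob ((A - B) \<union> (B - A))"
    "prob (A \<union> ((A - B) \<union> (B - A))) \<le> prob A + prob ((A - B) \<union> (B - A))"
    using assms by (intro measure_Un_le; auto)+
  ultimately show ?thesis by linarith
qed

text \<open>Taking the preimage under \<open>shift g\<close> amounts to summing over
  \<open>{g} + Q\<close> instead of \<open>Q\<close>, since
  \<open>shift g (shift h x) = shift (g + h) x\<close>; the sums differ only on the symmetric
  difference.\<close>

lemma visits_shift:
  assumes "invariant_set {g} \<delta> Q"
  shows "\<bar>visits x Q (shift g -` C) - visits x Q C\<bar> < \<delta>"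
proof -
  let ?\<phi> = "\<lambda>h. of_bool (shift h x \<in> C) :: real"
  have Q: "finite Q" "Q \<noteq> {}" "real (card ((Q - ({g} + Q)) \<union> (({g} + Q) - Q))) / real (card Q) < \<delta>"
    using assms by (auto simp: invariant_set_def)
  have gQ: "{g} + Q = (+) g ` Q" by (auto simp: set_plus_def)
  have "(\<Sum>h\<in>Q. of_bool (shift h x \<in> shift g -` C)) = (\<Sum>h\<in>{g} + Q. ?\<phi> h)"
    unfolding gQ by (subst sum.reindex) (auto simp: shift_shift o_def)
  then have "\<bar>visits x Q (shift g -` C) - visits x Q C\<bar>
      = \<bar>(\<Sum>h\<in>{g} + Q. ?\<phi> h) - (\<Sum>h\<in>Q. ?\<phi> h)\<bar> / real (card Q)"
    by (simp add: visits_def mean_def diff_divide_distrib[symmetric])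
  also have "\<dots> \<le> real (card ((({g} + Q) - Q) \<union> (Q - ({g} + Q)))) / real (card Q)"
    using Q(1) by (intro divide_right_mono abs_sum_diff_le_card) (auto simp: gQ)
  also have "\<dots> < \<delta>" using Q(3) by (simp add: Un_commute)
  finally show ?thesis .
qed

text \<open>What is kept of the tiling system. \<open>bounded\<close> reflects that a level has
  finitely many shapes: right quotients within its cells lie in one finite set.\<close>

locale folner_partitions = nested_partitions P
  for P :: "nat \<Rightarrow> 'g::{group_add,countable} \<Rightarrow> 'g set" +
  assumes folner: "finite L \<Longrightarrow> L \<noteq> {} \<Longrightarrow> 0 < \<delta> \<Longrightarrow> \<exists>k0. \<forall>k\<ge>k0. \<forall>g. invariant_set L \<delta> (P k g)"
    and bounded: "\<exists>L. finite L \<and> (\<forall>g. \<forall>h\<in>P k g. h - g \<in> L)"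
begin

lemma visits_UNIV: "visits x (P n g) UNIV = 1"
  unfolding visits_def by (simp add: mean_const finite_part part_ne)

end

text \<open>\<open>generic\<close> replaces the open set and the pseudometric: a cell of high level
  whose visit frequencies are close to those of an ergodic measure has no uncovered points.\<close>

locale uncovered_proportion = folner_partitions P
  for P :: "nat \<Rightarrow> 'g::{group_add,countable} \<Rightarrow> 'g set" +
  fixes X :: "('g \<Rightarrow> 'a::{finite,discrete_topology}) set"
    and u :: "('g \<Rightarrow> 'a) \<Rightarrow> nat \<Rightarrow> 'g \<Rightarrow> real"
  assumes X_nonempty: "X \<noteq> {}" and X_subshift: "subshift X"
    and u_nonneg: "0 \<le> u x n h" and u_le1: "u x n h \<le> 1"
    and u_anti: "q \<le> n \<Longrightarrow> u x n h \<le> u x q h"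
    and generic: "\<mu> \<in> ergodic_measures X \<Longrightarrow>
      \<exists>\<delta>>0. \<exists>\<C>. finite \<C> \<and> (\<forall>C\<in>\<C>. finitary C) \<and> (\<exists>k0. \<forall>q\<ge>k0. \<forall>x\<in>X. \<forall>g.
        (\<forall>C\<in>\<C>. \<bar>visits x (P q g) C - measure \<mu> (C \<inter> X)\<bar> < \<delta>) \<longrightarrow> (\<forall>h\<in>P q g. u x q h = 0))"
begin

text \<open>The uncovered indicator comes first, so that \<open>maximum 0\<close> is a bound over
  all states of high level, not only over selected ones. The later statistics ignore the level,
  hence are trivially monotone in it.\<close>

definition stat :: "nat \<Rightarrow> ('g \<Rightarrow> 'a) \<Rightarrow> nat \<Rightarrow> 'g \<Rightarrow> real" where
  "stat l x n h = (case l of 0 \<Rightarrow> u x n h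
     | Suc i \<Rightarrow> of_bool (shift h x \<in> from_nat_into {C. finitary C} i))"

sublocale lexicographic_maximum P X stat
  by unfold_locales (auto simp: stat_def X_nonempty u_nonneg u_le1 u_anti split: nat.split)

definition index :: "('g \<Rightarrow> 'a) set \<Rightarrow> nat" where
  "index C = Suc (to_nat_on {C. finitary C} C)"

lemma val_index: "finitary C \<Longrightarrow> val (index C) (x, n, g) = visits x (P n g) C"
  unfolding index_def visits_def val.simps by (rule mean_cong) (simp add: stat_def countable_finitary)

text \<open>Additivity and invariance are not visible in this form; they hold because
  \<open>\<nu> C\<close> turns out to be the limit of visit frequencies along nearly maximal
  states.\<close>

definition \<nu> :: "('g \<Rightarrow> 'a) set \<Rightarrow> real" where
  "\<nu> C = maximum (index C)"

text \<open>Being in \<open>near l p\<close> with \<open>l\<close> beyond all indices of the finite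
  family and \<open>p\<close> large controls all members at once, because \<open>near\<close> is
  antitone in both arguments.\<close>

lemma visits_near:
  assumes "finite \<C>" "\<And>C. C \<in> \<C> \<Longrightarrow> finitary C" "0 < \<delta>"
  obtains l p where "\<And>x n g C. (x, n, g) \<in> near l p \<Longrightarrow> C \<in> \<C> \<Longrightarrow> \<bar>visits x (P n g) C - \<nu> C\<bar> < \<delta>"
proof -
  have "\<exists>l p. \<forall>x n g. (x, n, g) \<in> near l p \<longrightarrow> (\<forall>C\<in>\<C>. \<bar>visits x (P n g) C - \<nu> C\<bar> < \<delta>)"
    using assms(1,2)
  proof (induction rule: finite_induct)
    case (insert C \<C>)
    obtain l p where lp: "\<And>x n g C. (x, n, g) \<in> near l p \<Longrightarrow> C \<in> \<C> \<Longrightarrow> \<bar>visits x (P n g) C - \<nu> C\<bar> < \<delta>"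
      using insert by blast
    obtain p' where p': "\<And>w. w \<in> near (Suc (index C)) p' \<Longrightarrow> \<bar>val (index C) w - maximum (index C)\<bar> < \<delta>"
      using value_near_maximum[OF assms(3)] by blast
    let ?l = "max l (Suc (index C))" and ?p = "max p p'"
    have "near ?l ?p \<subseteq> near l p" "near ?l ?p \<subseteq> near (Suc (index C)) p'"
      using near_anti near_anti_left by (meson max.cobounded1 max.cobounded2 order_trans)+
    moreover have "\<bar>visits x (P n g) C - \<nu> C\<bar> < \<delta>" if "(x, n, g) \<in> near (Suc (index C)) p'" for x n g
      using p'[OF that] val_index[of C] insert.prems by (simp add: \<nu>_def del: val.simps)
    ultimately show ?case using lp by (intro exI[of _ ?l] exI[of _ ?p]) blast
  qed auto
  then show ?thesis using that by blast
qed

end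

section \<open>The limit measure and its ergodicity\<close>

text \<open>A diagonal sequence of states: it eventually enters each \<open>near l p\<close>, so all
  visit frequencies converge along it without passing to subsequences.\<close>

locale limit_states = uncovered_proportion P X u
  for P :: "nat \<Rightarrow> 'g::{group_add,countable} \<Rightarrow> 'g set"
    and X :: "('g \<Rightarrow> 'a::{finite,discrete_topology}) set" and u +
  fixes x :: "nat \<Rightarrow> 'g \<Rightarrow> 'a" and n :: "nat \<Rightarrow> nat" and g :: "nat \<Rightarrow> 'g"
  assumes states_near: "(x j, n j, g j) \<in> near j j"
begin

lemma eventually_near: "eventually (\<lambda>j. (x j, n j, g j) \<in> near l p) sequentially"
proof -
  have "(x j, n j, g j) \<in> near l p" if "j \<ge> max l p" for j
    using states_near[of j] near_anti[of p j j] near_anti_left[of l j p] that by auto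
  then show ?thesis unfolding eventually_sequentially by blast
qed

lemma visits_tendsto:
  assumes "finitary C"
  shows "(\<lambda>j. visits (x j) (P (n j) (g j)) C) \<longlonglongrightarrow> \<nu> C"
proof (rule tendstoI)
  fix \<delta> :: real assume "0 < \<delta>"
  then obtain l p where "\<And>x n g D. (x, n, g) \<in> near l p \<Longrightarrow> D \<in> {C} \<Longrightarrow> \<bar>visits x (P n g) D - \<nu> D\<bar> < \<delta>"
    using visits_near[of "{C}" \<delta>] assms by blast
  then show "eventually (\<lambda>j. dist (visits (x j) (P (n j) (g j)) C) (\<nu> C) < \<delta>) sequentially"
    using eventually_near[of l p] by (auto simp: dist_real_def elim: eventually_mono)
qed

lemma \<nu>_nonneg: "0 \<le> \<nu> C"
  by (simp add: \<nu>_def maximum_nonneg)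

lemma \<nu>_Un:
  assumes "finitary C" "finitary D" "C \<inter> D = {}"
  shows "\<nu> (C \<union> D) = \<nu> C + \<nu> D"
  using LIMSEQ_unique[OF visits_tendsto[OF finitary_Un[OF assms(1,2)]]]
    tendsto_add[OF visits_tendsto[OF assms(1)] visits_tendsto[OF assms(2)]]
  by (simp add: visits_Un[OF assms(3)])

lemma \<nu>_UNIV: "\<nu> UNIV = 1"
  using LIMSEQ_unique[OF visits_tendsto[OF finitary_UNIV]] by (simp add: visits_UNIV)

lemma \<nu>_shift:
  assumes "finitary C"
  shows "\<nu> (shift a -` C) = \<nu> C"
proof -
  let ?d = "\<lambda>j. visits (x j) (P (n j) (g j)) (shift a -` C) - visits (x j) (P (n j) (g j)) C"
  have "?d \<longlonglongrightarrow> 0"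
  proof (rule tendstoI)
    fix \<delta> :: real assume "0 < \<delta>"
    then obtain k0 where k0: "\<And>k g. k \<ge> k0 \<Longrightarrow> invariant_set {a} \<delta> (P k g)"
      using folner[of "{a}" \<delta>] by auto
    show "eventually (\<lambda>j. dist (?d j) 0 < \<delta>) sequentially"
      using eventually_near[of 0 k0]
    proof eventually_elim
      case (elim j)
      then have "invariant_set {a} \<delta> (P (n j) (g j))" using k0 by auto
      then show ?case using visits_shift by (simp add: dist_real_def)
    qed
  qed
  then show ?thesis
    using LIMSEQ_unique[OF _ tendsto_diff[OF visits_tendsto[OF finitary_shift[OF assms]] visits_tendsto[OF assms]]]
    by fastforce
qed

lemma \<nu>_outside:
  assumes "finitary C" "C \<inter> X = {}"
  shows "\<nu> C = 0"
proof -
  have "shift h (x j) \<in> X" for h j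
    using X_subshift near_level[OF states_near[of j]] by (auto simp: subshift_def)
  then have "visits (x j) (P (n j) (g j)) C = 0" for j
    using assms(2) unfolding visits_def mean_def by (auto intro!: sum.neutral)
  then show ?thesis using LIMSEQ_unique[OF visits_tendsto[OF assms(1)]] by simp
qed

end

locale limit_measure = limit_states P X u x n g + prob_space M
  for P :: "nat \<Rightarrow> 'g::{group_add,countable} \<Rightarrow> 'g set"
    and X :: "('g \<Rightarrow> 'a::{finite,discrete_topology}) set" and u x n g
    and M :: "('g \<Rightarrow> 'a) measure" +
  assumes sets_M: "sets M = sets borel"
    and measure_finitary: "finitary C \<Longrightarrow> measure M C = \<nu> C"
begin

lemma space_M: "space M = UNIV"
  using sets_eq_imp_space_eq[OF sets_M] by simp

lemma finitary_event: "finitary C \<Longrightarrow> C \<in> events"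
  using sets_M finitary_borel by simp

lemma borel_shift: "shift a \<in> borel_measurable (borel :: ('g \<Rightarrow> 'a) measure)"
proof (rule borel_measurable_continuous_onI)
  show "continuous_on UNIV (shift a :: ('g \<Rightarrow> 'a) \<Rightarrow> 'g \<Rightarrow> 'a)"
    by (rule continuous_on_coordinatewise_then_product) (simp add: shift_def)
qed

lemma shift_event: "A \<in> events \<Longrightarrow> shift a -` A \<in> events"
  using measurable_sets[OF borel_shift] sets_M by fastforce

lemma measure_shift:
  assumes "A \<in> events"
  shows "measure M (shift a -` A) = measure M A"
proof -
  have meas: "shift a \<in> measurable M M"
    using borel_shift measurable_cong_sets[OF sets_M sets_M] by blast
  have "distr M M (shift a) = M"
  proof (rule measure_eqI_generator_eq[of "{C. finitary C}" UNIV])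
    show "Int_stable {C. finitary C}" by (auto simp: Int_stable_def intro: finitary_Int)
    show "emeasure (distr M M (shift a)) C = emeasure M C" if "C \<in> {C. finitary C}" for C
      using that \<nu>_shift
      by (simp add: emeasure_distr[OF meas] finitary_event space_M emeasure_eq_measure
          measure_finitary finitary_shift)
    show "range (\<lambda>_::nat. UNIV) \<subseteq> {C. finitary C}" by auto
  qed (auto simp: sets_M sigma_sets_finitary emeasure_distr[OF meas] finitary_event emeasure_eq_measure space_M)
  then show ?thesis
    using measure_distr[OF meas assms] by (simp add: space_M)
qed

lemma X_event: "X \<in> events"
  using X_subshift by (simp add: sets_M subshift_def borel_closed)

text \<open>The complement of the closed set \<open>X\<close> is a countable union of finitary sets
  disjoint from \<open>X\<close>, each null because orbits of points of \<open>X\<close> never visit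
  it.\<close>

lemma measure_Compl_X: "measure M (- X) = 0"
proof -
  have "open (- X)" using X_subshift by (simp add: subshift_def open_Compl)
  have "- X \<subseteq> \<Union>{C. finitary C \<and> C \<inter> X = {}}"
  proof
    fix y assume "y \<in> - X"
    then obtain C where "finitary C" "y \<in> C" "C \<subseteq> - X" by (rule open_finitary_nhd[OF \<open>open (- X)\<close>])
    then show "y \<in> \<Union>{C. finitary C \<and> C \<inter> X = {}}" by blast
  qed
  then have "- X = (\<Union>C\<in>{C. finitary C \<and> C \<inter> X = {}}. C)" by auto
  moreover have "countable {C :: ('g \<Rightarrow> 'a) set. finitary C \<and> C \<inter> X = {}}"
    by (rule countable_subset[OF _ countable_finitary]) auto
  then have "(\<Union>C\<in>{C. finitary C \<and> C \<inter> X = {}}. C) \<in> null_sets M"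
    by (rule null_sets_UN')
      (auto simp: null_sets_def finitary_event emeasure_eq_measure measure_finitary \<nu>_outside)
  ultimately show ?thesis by (simp add: null_sets_def measure_def)
qed

lemma measure_Int_X:
  assumes "A \<in> events" shows "measure M (A \<inter> X) = measure M A"
proof -
  have "measure M (A - X) = 0"
    using finite_measure_mono[of "A - X" "- X"] measure_Compl_X sets.compl_sets[OF X_event]
    by (auto simp: space_M Compl_eq_Diff_UNIV measure_le_0_iff)
  then show ?thesis
    using finite_measure_Diff'[OF assms X_event] by simp
qed

lemma restrict_invariant: "restrict_space M X \<in> invariant_measures X"
proof -
  have sets: "A \<in> sets (restrict_space M X) \<longleftrightarrow> A \<subseteq> X \<and> A \<in> events" for A
    by (rule sets_restrict_space_iff) (use X_event in simp)
  have meas: "measure (restrict_space M X) A = measure M A" if "A \<subseteq> X" for A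
    by (rule measure_restrict_space) (use X_event that in auto)
  have "emeasure (restrict_space M X) X = 1"
    using measure_Int_X[OF sets.top] X_event
    by (simp add: emeasure_restrict_space emeasure_eq_measure space_M prob_space[unfolded space_M])
  then have "prob_space (restrict_space M X)"
    by (intro prob_spaceI) (simp add: space_restrict_space2 X_event)
  moreover have "sets (restrict_space M X) = sets (restrict_space borel X)"
    by (rule sets_restrict_space_cong[OF sets_M])
  ultimately show ?thesis
    using sets meas by (auto simp: invariant_measures_def prob_measures_def measure_Int_X shift_event measure_shift)
qed

lemma visits_eventually:
  assumes "finitary C" "measure M C < r"
  shows "eventually (\<lambda>j. visits (x j) (P (n j) (g j)) C < r) sequentially"
  using order_tendstoD(2)[OF visits_tendsto[OF assms(1)], of r] assms by (simp add: measure_finitary)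

text \<open>
  \<open>C\<close> approximates \<open>A\<close> and determines the level \<open>q\<close>; \<open>C'\<close> is an approximation of \<open>A\<close> so much better that
  visits to \<open>C'\<close> are constant on most tiles of level \<open>q\<close>.
\<close>

lemma invariant_event_trivial:
  assumes A: "A \<in> events" and inv: "\<And>a. shift a -` A \<inter> X = A" and pos: "0 < measure M A" "measure M A < 1"
  shows False
proof -
  define t where "t = min (measure M A) (1 - measure M A)"
  \<comment> \<open>The contradiction needs slack \<open>10 * \<eta>\<close>:
    \<open>8 * \<eta>\<close> for passing from \<open>C\<close> to \<open>C'\<close> on a subcell,
    and \<eta> each for comparing \<open>\<nu> C\<close> with the visits and with the measure of
    \<open>A\<close>.\<close>
  define \<eta> where "\<eta> = t / 16"
  have t: "0 < t" "t \<le> measure M A" "t \<le> 1 - measure M A" using pos by (auto simp: t_def)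
  have \<eta>: "0 < \<eta>" "t = 16 * \<eta>" using t by (auto simp: \<eta>_def)
  obtain C where C: "finitary C" "measure M ((A - C) \<union> (C - A)) < \<eta>"
    using finitary_approximation[OF prob_space_axioms sets_M _ \<eta>(1)] A sets_M by auto
  have "\<bar>measure M A - measure M C\<bar> \<le> measure M ((A - C) \<union> (C - A))"
    using A finitary_event[OF C(1)] by (rule abs_measure_diff)
  then have AC: "\<bar>measure M A - \<nu> C\<bar> < \<eta>" using C measure_finitary by simp
  obtain l p where lp': "\<And>x n g D. (x, n, g) \<in> near l p \<Longrightarrow> D \<in> {C} \<Longrightarrow> \<bar>visits x (P n g) D - \<nu> D\<bar> < \<eta>"
    using visits_near[of "{C}" \<eta>] C(1) \<eta>(1) by blast
  have lp: "\<bar>visits x (P n g) C - \<nu> C\<bar> < \<eta>" if "(x, n, g) \<in> near l p" for x n g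
    using lp'[OF that] by simp
  obtain q where "\<exists>N. \<forall>x n g. (x, n, g) \<in> near l N \<longrightarrow>
      q \<le> n \<and> mean (P n g) (\<lambda>h. of_bool ((x, q, h) \<notin> near l p)) \<le> 1 / 4"
    using concentration[of "1 / 4" l p] order_refl zero_less_divide_1_iff zero_less_numeral by metis
  then obtain N where N: "\<And>x n g. (x, n, g) \<in> near l N \<Longrightarrow>
      q \<le> n \<and> mean (P n g) (\<lambda>h. of_bool ((x, q, h) \<notin> near l p)) \<le> 1 / 4"
    by blast
  obtain L where L: "finite L" "\<And>g h. h \<in> P q g \<Longrightarrow> h - g \<in> L" using bounded[of q] by blast
  \<comment> \<open>\<open>D\<close> will be a union of \<open>card L\<close> sets of measure at
    most \<open>2 * \<eta>'\<close>, so this keeps it below \<open>1 / 4\<close>; the bound \<eta>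
    serves for \<open>E\<close>.\<close>
  define \<eta>' where "\<eta>' = min \<eta> (1 / (16 * (real (card L) + 1)))"
  have \<eta>': "0 < \<eta>'" "\<eta>' \<le> \<eta>" "16 * (real (card L) + 1) * \<eta>' \<le> 1"
    using \<eta> by (auto simp: \<eta>'_def min_def field_simps)
  obtain C' where C': "finitary C'" "measure M ((A - C') \<union> (C' - A)) < \<eta>'"
    using finitary_approximation[OF prob_space_axioms sets_M _ \<eta>'(1)] A sets_M by auto
  let ?S = "\<lambda>a b :: ('g \<Rightarrow> 'a) set. (a - b) \<union> (b - a)"
  \<comment> \<open>A tile of level \<open>q\<close> on which visits to \<open>C'\<close> are not constant consists of visits to \<open>D\<close>.\<close>
  define D where "D = (\<Union>d\<in>L. ?S (shift d -` C') C')"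
  define E where "E = ?S C C'"
  have D: "finitary D" unfolding D_def
    by (intro finitary_UN L finitary_Un finitary_Diff finitary_shift C')
  have E: "finitary E" unfolding E_def by (intro finitary_Un finitary_Diff C C')
  have "measure M (?S (shift d -` C') C') \<le> 2 * \<eta>'" for d
  proof -
    let ?B = "?S A C'"
    have B: "?B \<in> events" using A finitary_event[OF C'(1)] by auto
    have X: "- X \<in> events" using X_event by (metis Compl_eq_Diff_UNIV sets.compl_sets space_M)
    \<comment> \<open>Invariance of \<open>A\<close> is available only inside \<open>X\<close>,
      whence the null set \<open>- X\<close>. For a point of \<open>X\<close>, either it or its
      translate is misclassified by \<open>C'\<close>.\<close>
    have "?S (shift d -` C') C' \<subseteq> - X \<union> (shift d -` ?B \<union> ?B)"
      using inv[of d] by blast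
    then have "measure M (?S (shift d -` C') C') \<le> measure M (- X \<union> (shift d -` ?B \<union> ?B))"
      using X B shift_event[OF B] by (intro finite_measure_mono) auto
    also have "\<dots> \<le> measure M (- X) + (measure M (shift d -` ?B) + measure M ?B)"
      using X B shift_event[OF B] by (intro order_trans[OF measure_Un_le] add_mono measure_Un_le) auto
    also have "\<dots> \<le> 2 * \<eta>'" using C'(2) unfolding measure_Compl_X measure_shift[OF B] by simp
    finally show ?thesis .
  qed
  then have "(\<Sum>d\<in>L. measure M (?S (shift d -` C') C')) \<le> real (card L) * (2 * \<eta>')"
    by (intro sum_bounded_above) auto
  moreover have "measure M D \<le> (\<Sum>d\<in>L. measure M (?S (shift d -` C') C'))"
    unfolding D_def using L(1)
    by (intro measure_UNION_le finitary_event finitary_Un finitary_Diff finitary_shift C')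
  moreover have "real (card L) * (2 * \<eta>') < 1 / 4" using \<eta>' by (simp add: algebra_simps)
  ultimately have MD: "measure M D < 1 / 4" by linarith
  have "measure M E \<le> measure M (?S A C \<union> ?S A C')"
    using A finitary_event[OF C(1)] finitary_event[OF C'(1)] unfolding E_def
    by (intro finite_measure_mono) auto
  also have "\<dots> \<le> measure M (?S A C) + measure M (?S A C')"
    using A finitary_event[OF C(1)] finitary_event[OF C'(1)] by (intro measure_Un_le) auto
  finally have ME: "measure M E < 3 * \<eta>" using C(2) C'(2) \<eta>'(2) \<eta>(1) by linarith
  have "eventually (\<lambda>j. False) sequentially"
    using eventually_near[of l N] visits_eventually[OF D MD] visits_eventually[OF E ME]
  proof eventually_elim
    case (elim j)
    let ?x = "x j" and ?Q = "P (n j) (g j)"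
    have q: "q \<le> n j" and bad: "mean ?Q (\<lambda>h. of_bool ((?x, q, h) \<notin> near l p)) \<le> 1 / 4"
      using N[OF elim(1)] by auto
    have E_mean: "mean ?Q (\<lambda>h. visits ?x (P q h) E) = visits ?x ?Q E"
      unfolding visits_def by (rule mean_mean[OF q])
    \<comment> \<open>Every subcell position is exceptional in one of three ways: a state that is
      not near, a visit to \<open>D\<close>, or too many visits to \<open>E\<close> in the subcell
      (weighted as in Markov's inequality). The averages of the three terms are at most
      \<open>1 / 4\<close>, below \<open>1 / 4\<close> and below \<open>1 / 2\<close>, which is
      impossible.\<close>
    have "1 \<le> of_bool ((?x, q, h) \<notin> near l p) + of_bool (shift h ?x \<in> D) + 1 / (8 * \<eta>) * visits ?x (P q h) E"
      for h
    proof (rule ccontr)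
      let ?R = "P q h"
      assume neg: "\<not> ?thesis"
      have E0: "0 \<le> 1 / (8 * \<eta>) * visits ?x ?R E" using \<eta>(1) visits_nonneg[of ?x ?R E] by simp
      have h: "(?x, q, h) \<in> near l p" "shift h ?x \<notin> D" "visits ?x ?R E < 8 * \<eta>"
      proof -
        show near: "(?x, q, h) \<in> near l p" by (rule ccontr) (use neg E0 in auto)
        show D: "shift h ?x \<notin> D" using neg E0 by auto
        show "visits ?x ?R E < 8 * \<eta>" using neg near D \<eta>(1) by (simp add: field_simps)
      qed
      have const: "shift h' ?x \<in> C' \<longleftrightarrow> shift h ?x \<in> C'" if "h' \<in> ?R" for h'
      proof -
        have "shift h' ?x = shift (h' - h) (shift h ?x)" by (simp add: shift_shift)
        then show ?thesis using h(2) L(2)[OF that] unfolding D_def by auto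
      qed
      have "visits ?x ?R C' = of_bool (shift h ?x \<in> C')"
        unfolding visits_def
        using mean_cong[of ?R "\<lambda>h. of_bool (shift h ?x \<in> C')" "\<lambda>_. of_bool (shift h ?x \<in> C')"] const
        by (simp add: mean_const finite_part part_ne)
      moreover have "visits ?x ?R C \<le> visits ?x ?R C' + visits ?x ?R E"
        "visits ?x ?R C' \<le> visits ?x ?R C + visits ?x ?R E"
        by (rule visits_le_Un; auto simp: E_def)+
      moreover have "\<bar>visits ?x ?R C - \<nu> C\<bar> < \<eta>" by (rule lp[OF h(1)])
      ultimately show False
        using h(3) AC t \<eta> by (cases "shift h ?x \<in> C'") auto
    qed
    then have "mean ?Q (\<lambda>_. 1) \<le> mean ?Q (\<lambda>h. of_bool ((?x, q, h) \<notin> near l p)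
        + of_bool (shift h ?x \<in> D) + 1 / (8 * \<eta>) * visits ?x (P q h) E)"
      by (rule mean_mono)
    then have "1 \<le> mean ?Q (\<lambda>h. of_bool ((?x, q, h) \<notin> near l p)) + visits ?x ?Q D
        + 1 / (8 * \<eta>) * visits ?x ?Q E"
      unfolding mean_add mean_cmult E_mean by (simp add: mean_const finite_part part_ne visits_def)
    moreover have "1 / (8 * \<eta>) * visits ?x ?Q E < 1 / 2"
      using elim(3) \<eta> by (simp add: field_simps)
    ultimately show False using bad elim(2) by linarith
  qed
  then show False by simp
qed

lemma restrict_ergodic: "restrict_space M X \<in> ergodic_measures X"
proof -
  have "measure M A = 0 \<or> measure M A = 1"
    if "A \<in> events" "\<And>a. shift a -` A \<inter> X = A" for A
    using invariant_event_trivial[OF that] prob_le_1[of A] measure_nonneg[of M A]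
    by (auto simp: less_le)
  then show ?thesis
    using restrict_invariant X_event
    by (auto simp: ergodic_measures_def sets_restrict_space_iff measure_restrict_space)
qed

text \<open>Near states of a fixed high level \<open>q\<close> have visit frequencies close to those
  of the ergodic limit measure, so by \<open>generic\<close> they have value 0. Most subcells of a
  very near state are of this kind, so its uncovered proportion is at most
  \<open>maximum 0 / 4\<close>, although it should be close to \<open>maximum 0\<close>.\<close>

lemma maximum_0: "maximum 0 = 0"
proof (rule ccontr)
  assume "maximum 0 \<noteq> 0"
  then have pos: "0 < maximum 0" using maximum_nonneg[of 0] by simp
  have meas: "measure (restrict_space M X) (C \<inter> X) = \<nu> C" if "finitary C" for C
    using that X_event by (simp add: measure_restrict_space measure_Int_X finitary_event measure_finitary)
  from generic[OF restrict_ergodic] obtain \<delta> \<C> k0 where "0 < \<delta>" and \<C>: "finite \<C>" "\<forall>C\<in>\<C>. finitary C"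
    and k0: "\<forall>q\<ge>k0. \<forall>x\<in>X. \<forall>g.
      (\<forall>C\<in>\<C>. \<bar>visits x (P q g) C - measure (restrict_space M X) (C \<inter> X)\<bar> < \<delta>) \<longrightarrow> (\<forall>h\<in>P q g. u x q h = 0)"
    by blast
  obtain l p where lp: "\<And>x n g C. (x, n, g) \<in> near l p \<Longrightarrow> C \<in> \<C> \<Longrightarrow> \<bar>visits x (P n g) C - \<nu> C\<bar> < \<delta>"
    using visits_near[OF \<C>(1) _ \<open>0 < \<delta>\<close>] \<C>(2) by blast
  obtain q0 where q0: "\<And>q. q \<ge> q0 \<Longrightarrow> \<exists>N. \<forall>x n g. (x, n, g) \<in> near l N \<longrightarrow>
      q \<le> n \<and> mean (P n g) (\<lambda>h. of_bool ((x, q, h) \<notin> near l p)) \<le> maximum 0 / 4"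
    using concentration[of "maximum 0 / 4" l p] pos by auto
  define q where "q = max q0 k0"
  obtain N where N: "\<And>x n g. (x, n, g) \<in> near l N \<Longrightarrow>
      q \<le> n \<and> mean (P n g) (\<lambda>h. of_bool ((x, q, h) \<notin> near l p)) \<le> maximum 0 / 4"
    using q0[of q] by (auto simp: q_def)
  obtain N' where N': "\<And>w. w \<in> near (Suc 0) N' \<Longrightarrow> \<bar>val 0 w - maximum 0\<bar> < maximum 0 / 2"
    using value_near_maximum[of "maximum 0 / 2" 0 0] pos by auto
  have "eventually (\<lambda>j. False) sequentially"
    using eventually_near[of l N] eventually_near[of "Suc 0" N']
  proof eventually_elim
    case (elim j)
    let ?x = "x j" and ?Q = "P (n j) (g j)"
    have x: "?x \<in> X" using near_level[OF elim(1)] by simp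
    have q: "q \<le> n j" and bad: "mean ?Q (\<lambda>h. of_bool ((?x, q, h) \<notin> near l p)) \<le> maximum 0 / 4"
      using N[OF elim(1)] by auto
    have "val 0 (?x, n j, g j) \<le> mean ?Q (\<lambda>h. val 0 (?x, q, h))" by (rule value_le_mean_value[OF q])
    also have "\<dots> \<le> mean ?Q (\<lambda>h. of_bool ((?x, q, h) \<notin> near l p))"
    proof (rule mean_mono)
      fix h
      show "val 0 (?x, q, h) \<le> of_bool ((?x, q, h) \<notin> near l p)"
      proof (cases "(?x, q, h) \<in> near l p")
        case True
        have "\<forall>C\<in>\<C>. \<bar>visits ?x (P q h) C - measure (restrict_space M X) (C \<inter> X)\<bar> < \<delta>"
          using lp[OF True] meas \<C>(2) by simp
        moreover have "k0 \<le> q" by (simp add: q_def)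
        ultimately have "u ?x q h' = 0" if "h' \<in> P q h" for h'
          using k0 x that by blast
        then have "val 0 (?x, q, h) = 0" by (simp add: stat_def mean_def)
        then show ?thesis by simp
      next
        case False
        then show ?thesis using value_le1[of 0 "(?x, q, h)"] by (simp del: val.simps)
      qed
    qed
    finally show False using bad N'[OF elim(2)] pos by linarith
  qed
  then show False by simp
qed

end

section \<open>Uniform bound on the uncovered proportion\<close>

context uncovered_proportion
begin

text \<open>\<open>near 0 N\<close> contains every state over \<open>X\<close> of level at least
  \<open>N\<close>, so the vanishing of \<open>maximum 0\<close> gives a bound uniform in
  \<open>x\<close> and in the cell.\<close>

theorem uncovered_proportion_small:
  assumes "0 < \<epsilon>"
  shows "\<exists>n\<ge>m. \<forall>x\<in>X. \<forall>g. mean (P n g) (u x n) < \<epsilon>"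
proof -
  have "\<forall>j. \<exists>w. w \<in> near j j" using near_ne by blast
  then obtain v where v: "\<And>j. v j \<in> near j j" by metis
  interpret limit_states P X u "\<lambda>j. fst (v j)" "\<lambda>j. fst (snd (v j))" "\<lambda>j. snd (snd (v j))"
    by unfold_locales (use v in simp)
  obtain M where "prob_space M" "sets M = sets borel" "\<forall>C. finitary C \<longrightarrow> measure M C = \<nu> C"
    by (rule finitary_measure_extension[of \<nu>, OF \<nu>_nonneg \<nu>_Un \<nu>_UNIV]) auto
  then interpret limit_measure P X u "\<lambda>j. fst (v j)" "\<lambda>j. fst (snd (v j))" "\<lambda>j. snd (snd (v j))" M
    by (intro limit_measure.intro limit_measure_axioms.intro limit_states_axioms) auto
  obtain N where N: "N \<ge> m" "\<And>w. w \<in> near 0 N \<Longrightarrow> val 0 w < maximum 0 + \<epsilon>"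
    using value_le_maximum[OF assms] by blast
  have "mean (P N g) (u x N) < \<epsilon>" if "x \<in> X" for x g
    using N(2)[of "(x, N, g)"] that by (simp add: maximum_0 stat_def cong: mean_cong)
  then show ?thesis using N(1) by blast
qed

end


section \<open>Cores of invariant sets, and the partitions given by the tiles\<close>

lemma card_rtrans: "card (rtrans F c) = card F"
  unfolding rtrans_def by (rule card_image) (simp add: inj_on_def)

lemma rtrans_Un: "rtrans (A \<union> B) c = rtrans A c \<union> rtrans B c"
  by (auto simp: rtrans_def)

lemma rtrans_Diff: "rtrans (A - B) c = rtrans A c - rtrans B c"
  unfolding rtrans_def by (rule image_set_diff) (simp add: inj_on_def)

lemma set_plus_rtrans: "L + rtrans F c = rtrans (L + F) c"
  by (force simp: rtrans_def set_plus_def add.assoc)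

lemma invariant_set_rtrans: "invariant_set L \<delta> F \<Longrightarrow> invariant_set L \<delta> (rtrans F c)"
  unfolding invariant_set_def set_plus_rtrans rtrans_Diff[symmetric] rtrans_Un[symmetric] card_rtrans
  by (auto simp: rtrans_def)

text \<open>A point of \<open>Q\<close> outside the core is moved out of \<open>Q\<close> by some
  \<open>k\<close> in \<open>K\<close>, and left translation by that \<open>k\<close> is injective
  into \<open>(L + Q) - Q\<close>. A larger \<open>L\<close> is allowed so that one invariance
  condition serves many windows \<open>K\<close>.\<close>

lemma card_Diff_core:
  assumes "finite Q" "finite L" "K \<subseteq> L"
  shows "card (Q - core K Q) \<le> card K * card ((L + Q) - Q)"
proof -
  have K: "finite K" using assms finite_subset by blast
  have fin: "finite ((L + Q) - Q)" using assms by (simp add: finite_set_plus)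
  have "card (Q - core K Q) \<le> card (\<Union>k\<in>K. {g \<in> Q. k + g \<notin> Q})"
    using assms(1) K by (intro card_mono) (auto simp: core_def rtrans_def)
  also have "\<dots> \<le> (\<Sum>k\<in>K. card {g \<in> Q. k + g \<notin> Q})" by (rule card_UN_le[OF K])
  also have "\<dots> \<le> (\<Sum>k\<in>K. card ((L + Q) - Q))"
  proof (rule sum_mono)
    fix k assume "k \<in> K"
    then show "card {g \<in> Q. k + g \<notin> Q} \<le> card ((L + Q) - Q)"
      using assms(3) by (intro card_inj_on_le[OF _ _ fin, of "(+) k"]) (auto intro: set_plus_intro)
  qed
  finally show ?thesis by simp
qed

lemma Diff_core_small:
  assumes "invariant_set L \<delta> Q" "finite L" "K \<subseteq> L"
  shows "real (card (Q - core K Q)) \<le> real (card K) * \<delta> * real (card Q)"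
proof -
  have Q: "finite Q" "0 < card Q"
    and inv: "real (card ((Q - (L + Q)) \<union> ((L + Q) - Q))) / real (card Q) < \<delta>"
    using assms(1) by (auto simp: invariant_set_def card_gt_0_iff)
  have "card ((L + Q) - Q) \<le> card ((Q - (L + Q)) \<union> ((L + Q) - Q))"
    using Q(1) assms(2) by (intro card_mono) (auto simp: finite_set_plus)
  also have "real \<dots> \<le> \<delta> * real (card Q)" using inv Q(2) by (simp add: field_simps)
  finally have *: "real (card ((L + Q) - Q)) \<le> \<delta> * real (card Q)" by simp
  have "real (card (Q - core K Q)) \<le> real (card K) * real (card ((L + Q) - Q))"
    using card_Diff_core[OF Q(1) assms(2,3)] by (metis of_nat_le_iff of_nat_mult)
  also have "\<dots> \<le> real (card K) * (\<delta> * real (card Q))" by (intro mult_left_mono *) simp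
  finally show ?thesis by (simp add: mult.assoc)
qed

lemma tilesE:
  assumes "is_tiling S T" "Q \<in> tiles S T"
  obtains F c where "F \<in> set S" "Q = rtrans F c"
proof -
  obtain c i where c: "T c = Some i" "Q = rtrans (S ! i) c"
    using assms(2) by (auto simp: tiles_def tile_def)
  then have "Some i \<in> symbols S" using assms(1) unfolding is_tiling_def by (metis rangeI subsetD)
  then show ?thesis using c that[of "S ! i" c] by (auto simp: symbols_def)
qed

lemma tiling_system_tiling:
  assumes "tiling_system S TT W" "T \<in> W"
  shows "is_tiling (S k) (T k)"
proof -
  have "T k \<in> TT k"
    using assms closedin_subset by (fastforce simp: tiling_system_def PiE_iff)
  then show ?thesis using assms(1) by (auto simp: tiling_system_def dynamical_tiling_def)
qed

lemma partition_on_Union_containing: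
  assumes "partition_on UNIV \<A>" "Q \<in> \<A>" "g \<in> Q"
  shows "\<Union>{R\<in>\<A>. g \<in> R} = Q"
proof -
  have "{R\<in>\<A>. g \<in> R} = {Q}"
    using assms partition_onD2[OF assms(1)] by (auto simp: disjoint_def)
  then show ?thesis by simp
qed

text \<open>The tiles partition the group, so the union has exactly one member.\<close>

definition tile_at :: "(nat \<Rightarrow> 'g::group_add set list) \<Rightarrow> (nat \<Rightarrow> 'g tiling) \<Rightarrow> nat \<Rightarrow> 'g \<Rightarrow> 'g set" where
  "tile_at S T k g = \<Union>{Q \<in> tiles (S k) (T k). g \<in> Q}"

lemma tile_at_eq:
  assumes "is_tiling (S k) (T k)" "Q \<in> tiles (S k) (T k)" "g \<in> Q"
  shows "tile_at S T k g = Q"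
proof -
  have "partition_on UNIV (tiles (S k) (T k))" using assms(1) by (simp add: is_tiling_def)
  then show ?thesis unfolding tile_at_def using assms(2,3) by (rule partition_on_Union_containing)
qed

lemma tile_at:
  assumes "is_tiling (S k) (T k)"
  shows "tile_at S T k g \<in> tiles (S k) (T k)" "g \<in> tile_at S T k g"
proof -
  obtain Q where "Q \<in> tiles (S k) (T k)" "g \<in> Q"
    using assms partition_onD1[of UNIV "tiles (S k) (T k)"] unfolding is_tiling_def by blast
  with tile_at_eq[of S k T, OF assms this] show "tile_at S T k g \<in> tiles (S k) (T k)" "g \<in> tile_at S T k g" by auto
qed

text \<open>Congruence gives nesting, and invariance of shapes passes to their right translates.
  Boundedness holds because \<open>(f + c) - (f' + c) = f - f'\<close> depends only on the
  shape.\<close>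

lemma folner_partitions_tile_at:
  fixes S :: "nat \<Rightarrow> 'g::{group_add,countable} set list"
  assumes sys: "tiling_system S TT W" and "folner_system S" and cong: "congruent_system S W" and T: "T \<in> W"
  shows "folner_partitions (tile_at S T)"
proof -
  have tiling: "is_tiling (S k) (T k)" for k by (rule tiling_system_tiling[OF sys T])
  have at: "tile_at S T k g \<in> tiles (S k) (T k)" "g \<in> tile_at S T k g" for k g
    using tile_at[of S k T g] tiling[of k] by blast+
  have eq: "tile_at S T k g = Q" if "Q \<in> tiles (S k) (T k)" "g \<in> Q" for k g Q
    using tile_at_eq[of S k T Q g] tiling[of k] that by blast
  have shapes: "\<exists>F\<in>set (S k). \<exists>c. tile_at S T k g = rtrans F c" for k g
    by (rule tilesE[OF tiling[of k] at(1)[of k g]]) blast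
  have fin: "finite F" if "F \<in> set (S k)" for F k
  proof -
    have "shape_collection (S k)" using sys unfolding tiling_system_def dynamical_tiling_def by blast
    then show ?thesis using that unfolding shape_collection_def by blast
  qed
  show ?thesis
  proof
    fix k g h
    obtain F c where "F \<in> set (S k)" "tile_at S T k g = rtrans F c" using shapes by blast
    then show "finite (tile_at S T k g)" using fin[of F k] by (simp add: rtrans_def)
    show "g \<in> tile_at S T k g" by (rule at(2))
    show "h \<in> tile_at S T k g \<Longrightarrow> tile_at S T k h = tile_at S T k g" by (rule eq[OF at(1)])
    have "\<forall>Q\<in>tiles (S (Suc k)) (T (Suc k)). \<exists>\<A>\<subseteq>tiles (S k) (T k). Q = \<Union>\<A>"
      using cong T by (simp add: congruent_system_def)
    from bspec[OF this at(1)[of "Suc k" g]]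
    obtain \<A> where \<A>: "\<A> \<subseteq> tiles (S k) (T k)" "tile_at S T (Suc k) g = \<Union>\<A>"
      by (elim exE conjE)
    then obtain R where R: "R \<in> \<A>" "g \<in> R" using at(2)[of g "Suc k"] by auto
    then have "tile_at S T k g = R" by (intro eq subsetD[OF \<A>(1)])
    then show "tile_at S T k g \<subseteq> tile_at S T (Suc k) g" unfolding \<A>(2) using R(1) by (simp add: Union_upper)
  next
    fix L :: "'g set" and \<delta> :: real assume "finite L" "L \<noteq> {}" "0 < \<delta>"
    then have "\<exists>k0. \<forall>k\<ge>k0. \<forall>F\<in>set (S k). invariant_set L \<delta> F"
      using \<open>folner_system S\<close> by (simp add: folner_system_def)
    then obtain k0 where "\<forall>k\<ge>k0. \<forall>F\<in>set (S k). invariant_set L \<delta> F" ..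
    then have "invariant_set L \<delta> (tile_at S T k g)" if "k \<ge> k0" for k g
      using shapes[of k g] that by (elim bexE exE) (simp add: invariant_set_rtrans)
    then show "\<exists>k0. \<forall>k\<ge>k0. \<forall>g. invariant_set L \<delta> (tile_at S T k g)" by blast
  next
    fix k
    let ?L = "\<Union>F\<in>set (S k). (\<lambda>(f, f'). f - f') ` (F \<times> F)"
    have "h - g \<in> ?L" if h: "h \<in> tile_at S T k g" for g h
    proof -
      obtain F c where F: "F \<in> set (S k)" "tile_at S T k g = rtrans F c" using shapes by blast
      then obtain f f' where "f \<in> F" "f' \<in> F" "h = f + c" "g = f' + c"
        using h at(2)[of g k] by (auto simp: rtrans_def)
      then have "h - g = f - f'" by (simp add: diff_conv_add_uminus minus_add add.assoc del: add_uminus_conv_diff)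
      then show ?thesis using F(1) \<open>f \<in> F\<close> \<open>f' \<in> F\<close> by auto
    qed
    moreover have "finite ?L" using fin[of _ k] by auto
    ultimately show "\<exists>L. finite L \<and> (\<forall>g. \<forall>h\<in>tile_at S T k g. h - g \<in> L)" by blast
  qed
qed

section \<open>Block frequencies and the pseudometric\<close>

lemma finite_blocks: "finite K \<Longrightarrow> finite {C :: ('g, 'a::finite) block. dom C = K}"
  using finite_set_of_finite_maps[of K "UNIV :: 'a set"] by simp

lemma dom_restr [simp]: "dom (restr x Q) = Q"
  by (auto simp: restr_def restrict_map_def dom_def split: if_splits)

lemma restr_eq_iff: "restr x (dom C) = C \<longleftrightarrow> (\<forall>k\<in>dom C. C k = Some (x k))"
proof
  assume "restr x (dom C) = C"
  then show "\<forall>k\<in>dom C. C k = Some (x k)" by (metis restr_def restrict_in)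
next
  assume "\<forall>k\<in>dom C. C k = Some (x k)"
  then show "restr x (dom C) = C" by (auto simp: restr_def restrict_map_def fun_eq_iff domIff)
qed

lemma finitary_restr: "finite (dom C) \<Longrightarrow> finitary {x. restr x (dom C) = C}"
  by (rule finitaryI[of "dom C"]) (auto simp: restr_eq_iff)

lemma restr_in_blocks:
  assumes "x \<in> X" "finite Q" "Q \<noteq> {}"
  shows "restr x Q \<in> blocks X"
proof -
  have "similar (restr x Q) 0 (restr x (rtrans Q 0))" by (simp add: similar_def rtrans_def)
  then have "occurs (restr x Q) x" unfolding occurs_def by auto
  then show ?thesis using assms unfolding blocks_def by (simp only: mem_Collect_eq dom_restr) blast
qed

text \<open>In the core the whole translated window lies in \<open>Q\<close>, so an occurrence in
  the block is a visit of the orbit of \<open>x\<close> to a cylinder.\<close>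

lemma similar_restr_iff:
  assumes "g \<in> core (dom C) Q"
  shows "similar C g (restr x Q |` rtrans (dom C) g) \<longleftrightarrow> restr (shift g x) (dom C) = C"
  unfolding restr_eq_iff similar_def using assms
  by (auto simp: core_def shift_def restr_def rtrans_def subset_iff restrict_map_def dom_def split: if_splits)

lemma Fr_restr:
  "Fr (restr x Q) C = real (card {g \<in> core (dom C) Q. restr (shift g x) (dom C) = C}) / real (card Q)"
  unfolding Fr_def by (simp add: similar_restr_iff cong: conj_cong)

text \<open>\<open>Fr\<close> counts positions in the core only, \<open>visits\<close> counts all of
  \<open>Q\<close>; the difference is at most the small part of \<open>Q\<close> outside the
  core.\<close>

lemma Fr_restr_visits:
  assumes "invariant_set L \<delta> Q" "finite L" "dom C \<subseteq> L"
  shows "\<bar>Fr (restr x Q) C - visits x Q {x. restr x (dom C) = C}\<bar> \<le> real (card (dom C)) * \<delta>"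
proof -
  have Q: "finite Q" "0 < card Q" using assms(1) by (auto simp: invariant_set_def card_gt_0_iff)
  let ?V = "{g \<in> Q. restr (shift g x) (dom C) = C}"
  have fin: "finite ?V" "finite (Q - core (dom C) Q)" using Q(1) by auto
  have F: "{g \<in> core (dom C) Q. restr (shift g x) (dom C) = C} \<subseteq> ?V" by (auto simp: core_def)
  have "card ?V \<le> card ({g \<in> core (dom C) Q. restr (shift g x) (dom C) = C} \<union> (Q - core (dom C) Q))"
    using fin F by (intro card_mono) (auto intro: finite_subset)
  then have "card ?V \<le> card {g \<in> core (dom C) Q. restr (shift g x) (dom C) = C} + card (Q - core (dom C) Q)"
    by (rule order_trans[OF _ card_Un_le])
  moreover have "card {g \<in> core (dom C) Q. restr (shift g x) (dom C) = C} \<le> card ?V"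
    by (rule card_mono[OF fin(1) F])
  ultimately have "\<bar>real (card {g \<in> core (dom C) Q. restr (shift g x) (dom C) = C}) - real (card ?V)\<bar>
      \<le> real (card (Q - core (dom C) Q))" by simp
  also have "\<dots> \<le> real (card (dom C)) * \<delta> * real (card Q)" by (rule Diff_core_small[OF assms])
  finally show ?thesis
    using Q unfolding Fr_restr visits_def
    by (simp add: mean_of_bool diff_divide_distrib[symmetric] field_simps)
qed

lemma real_divide_le_1: "a \<le> b \<Longrightarrow> real a / real b \<le> 1"
  by (cases "b = 0") (simp_all add: divide_le_eq_1)

text \<open>Each position carries at most one block with domain \<open>K\<close>, so the counted
  sets are disjoint.\<close>

lemma sum_Fr_restr_le:
  fixes x :: "'g::group_add \<Rightarrow> 'a::finite"
  assumes "finite Q" "Q \<noteq> {}" "finite K"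
  shows "(\<Sum>C | dom C = K. Fr (restr x Q) C) \<le> 1"
proof -
  let ?N = "\<lambda>C. {g \<in> core (dom C) Q. restr (shift g x) (dom C) = C}"
  have "(\<Sum>C | dom C = K. card (?N C)) = card (\<Union>C\<in>{C. dom C = K}. ?N C)"
    using assms(1) by (intro card_UN_disjoint[symmetric] finite_blocks assms(3)) (auto simp: core_def)
  also have "\<dots> \<le> card Q" using assms(1) by (intro card_mono) (auto simp: core_def)
  finally have le: "(\<Sum>C | dom C = K. card (?N C)) \<le> card Q" .
  from real_divide_le_1[OF le] show ?thesis
    unfolding Fr_restr of_nat_sum sum_divide_distrib .
qed

lemma cylinder_eq: "cylinder X C = {x. restr x (dom C) = C} \<inter> X"
  by (auto simp: cylinder_def)

lemma sum_cylinder_le: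
  fixes X :: "('g::{group_add,countable} \<Rightarrow> 'a::{finite,discrete_topology}) set"
  assumes "\<mu> \<in> prob_measures X" "finite K"
  shows "(\<Sum>C | dom C = K. measure \<mu> (cylinder X C)) \<le> 1"
proof -
  interpret prob_space \<mu> using assms(1) by (simp add: prob_measures_def)
  have "cylinder X C \<in> events" if "dom C = K" for C
  proof -
    have "{x. restr x (dom C) = C} \<in> sets (borel :: ('g \<Rightarrow> 'a) measure)"
      by (rule finitary_borel[OF finitary_restr]) (simp add: that assms(2))
    then have "X \<inter> {x. restr x (dom C) = C} \<in> sets (restrict_space borel X)"
      unfolding sets_restrict_space by (rule imageI)
    then show ?thesis using assms(1) by (simp add: prob_measures_def cylinder_eq Int_commute)
  qed
  then have "(\<Sum>C | dom C = K. prob (cylinder X C)) = prob (\<Union>C\<in>{C. dom C = K}. cylinder X C)"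
    by (intro finite_measure_finite_Union[symmetric] finite_blocks assms(2))
      (auto simp: disjoint_family_on_def cylinder_def)
  then show ?thesis by simp
qed

lemma suminf_half_weights_less:
  fixes a :: "nat \<Rightarrow> real"
  assumes "\<And>l. 0 \<le> a l" "\<And>l. a l \<le> (1 / 2) ^ l" "(\<Sum>l<N. a l) < r / 2" "2 * (1 / 2) ^ N < r / 2"
  shows "suminf a < r"
proof -
  have geo: "summable (\<lambda>l. (1 / 2) ^ l :: real)" by (simp add: summable_geometric)
  have sum: "summable a"
    by (rule summable_comparison_test[OF _ geo]) (use assms(1,2) in auto)
  have "(\<Sum>l. a (l + N)) \<le> (\<Sum>l. (1 / 2) ^ N * (1 / 2) ^ l)"
    using assms(2)[of "_ + N"]
    by (intro suminf_le summable_ignore_initial_segment sum summable_mult geo)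
      (simp add: power_add mult.commute)
  also have "\<dots> = (1 / 2) ^ N * (\<Sum>l. (1 / 2) ^ l)" by (rule suminf_mult[OF geo])
  also have "\<dots> = 2 * (1 / 2) ^ N" by (simp add: suminf_geometric)
  finally show ?thesis using suminf_split_initial_segment[OF sum, of N] assms(3,4) by simp
qed


text \<open>Finitely many terms of the series are controlled by finitely many cylinder frequencies.
  In the remaining terms both total masses are at most 1, so they are dominated by a geometric
  series.\<close>

lemma dstar_small:
  fixes X :: "('g::{group_add,countable} \<Rightarrow> 'a::{finite,discrete_topology}) set"
    and K :: "nat \<Rightarrow> 'g set"
  assumes fin: "\<And>l. finite (K l)" and \<mu>: "\<mu> \<in> prob_measures X" and "0 < r"
  shows "\<exists>\<delta> \<C> L. 0 < \<delta> \<and> finite \<C> \<and> (\<forall>C\<in>\<C>. finitary C) \<and> finite L \<and> L \<noteq> {} \<and>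
    (\<forall>x Q. invariant_set L \<delta> Q \<longrightarrow> (\<forall>C\<in>\<C>. \<bar>visits x Q C - measure \<mu> (C \<inter> X)\<bar> < \<delta>) \<longrightarrow>
       dstar K X (Inr \<mu>) (Inl (restr x Q)) < r)"
proof -
  have "(\<lambda>N. 2 * (1 / 2) ^ N :: real) \<longlonglongrightarrow> 2 * 0"
    by (intro tendsto_mult tendsto_const LIMSEQ_power_zero) simp
  then have "eventually (\<lambda>N. 2 * (1 / 2) ^ N < r / 2) sequentially"
    by (rule order_tendstoD(2)) (use \<open>0 < r\<close> in simp)
  then obtain N where N: "2 * (1 / 2) ^ N < r / 2"
    by (auto simp: eventually_sequentially)
  let ?B = "\<lambda>l. {C :: ('g, 'a) block. dom C = K l}"
  \<comment> \<open>Each of the \<open>card (?B l)\<close> summands is at most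
    \<open>(card (K l) + 1) * \<delta>\<close>: \<open>card (K l) * \<delta>\<close> for the
    boundary and \<delta> for the visits. Hence the head of the series is at most
    \<open>n * \<delta>\<close>.\<close>
  define n where "n = (\<Sum>l<N. card (?B l) * (card (K l) + 1))"
  define \<delta> where "\<delta> = r / (2 * (real n + 1))"
  have \<delta>: "0 < \<delta>" "real n * \<delta> < r / 2"
    using \<open>0 < r\<close> by (auto simp: \<delta>_def field_simps)
  define \<C> where "\<C> = (\<lambda>C. {x :: 'g \<Rightarrow> 'a. restr x (dom C) = C}) ` (\<Union>l<N. ?B l)"
  \<comment> \<open>A window containing the domains of all blocks considered; \<open>0\<close> is
    inserted to make it nonempty in any case, as the Folner condition requires.\<close>
  define L where "L = insert 0 (\<Union>l<N. K l)"
  have L: "finite L" "L \<noteq> {}" using fin by (auto simp: L_def)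
  have \<C>: "finite \<C>" unfolding \<C>_def using finite_blocks[OF fin] by auto
  have "finitary {x :: 'g \<Rightarrow> 'a. restr x (dom C) = C}" if "C \<in> ?B l" for C l
    by (rule finitary_restr) (use that fin in simp)
  then have finitary: "\<forall>C\<in>\<C>. finitary C" unfolding \<C>_def by blast
  have "dstar K X (Inr \<mu>) (Inl (restr x Q)) < r"
    if inv: "invariant_set L \<delta> Q" and close: "\<forall>C\<in>\<C>. \<bar>visits x Q C - measure \<mu> (C \<inter> X)\<bar> < \<delta>" for x Q
  proof -
    have Q: "finite Q" "Q \<noteq> {}" using inv by (auto simp: invariant_set_def)
    define s where "s l = (\<Sum>C\<in>?B l. \<bar>measure \<mu> (cylinder X C) - Fr (restr x Q) C\<bar>)" for l
    define a where "a l = (1 / 2) ^ Suc l / (real (card (K l)) + 1) * s l" for l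
    have s0: "0 \<le> s l" for l unfolding s_def by (intro sum_nonneg) simp
    have coeff: "(1 / 2) ^ Suc l / (real (card (K l)) + 1) \<le> (1 / 2 :: real) ^ Suc l" for l
      by (simp add: divide_le_eq)
    have a0: "0 \<le> a l" for l unfolding a_def using s0 by simp
    have "s l \<le> (\<Sum>C\<in>?B l. measure \<mu> (cylinder X C) + Fr (restr x Q) C)" for l
    proof -
      have "0 \<le> Fr (restr x Q) C" for C unfolding Fr_def by simp
      then have "\<bar>measure \<mu> (cylinder X C) - Fr (restr x Q) C\<bar> \<le> measure \<mu> (cylinder X C) + Fr (restr x Q) C" for C
        using measure_nonneg[of \<mu> "cylinder X C"] by (smt (verit))
      then show ?thesis unfolding s_def by (intro sum_mono)
    qed
    also have "(\<Sum>C\<in>?B l. measure \<mu> (cylinder X C) + Fr (restr x Q) C) \<le> 2" for l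
      using sum_cylinder_le[OF \<mu> fin[of l]] sum_Fr_restr_le[OF Q fin[of l], of x]
      unfolding sum.distrib by linarith
    finally have s2: "s l \<le> 2" for l .
    have a2: "a l \<le> (1 / 2) ^ l" for l
    proof -
      have "a l \<le> (1 / 2) ^ Suc l * 2" unfolding a_def
        by (intro mult_mono coeff s2 s0) simp
      then show ?thesis by simp
    qed
    have "a l \<le> real (card (?B l) * (card (K l) + 1)) * \<delta>" if l: "l < N" for l
    proof -
      have "\<bar>measure \<mu> (cylinder X C) - Fr (restr x Q) C\<bar> \<le> (real (card (K l)) + 1) * \<delta>" if C: "C \<in> ?B l" for C
      proof -
        have "\<bar>Fr (restr x Q) C - visits x Q {x. restr x (dom C) = C}\<bar> \<le> real (card (dom C)) * \<delta>"
          by (rule Fr_restr_visits[OF inv L(1)]) (use C l in \<open>auto simp: L_def\<close>)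
        moreover have "\<bar>visits x Q {x. restr x (dom C) = C} - measure \<mu> (cylinder X C)\<bar> < \<delta>"
          unfolding cylinder_eq
          by (rule bspec[OF close], unfold \<C>_def, rule imageI) (use C l in auto)
        ultimately show ?thesis using C by (simp add: algebra_simps)
      qed
      then have "s l \<le> real (card (?B l)) * ((real (card (K l)) + 1) * \<delta>)"
        unfolding s_def by (rule sum_bounded_above)
      moreover have "(1 / 2 :: real) ^ Suc l \<le> 1" by (rule power_le_one) auto
      then have "a l \<le> 1 * s l" unfolding a_def using coeff[of l]
        by (intro mult_right_mono s0) linarith
      ultimately show ?thesis by (simp add: algebra_simps)
    qed
    then have "(\<Sum>l<N. a l) \<le> (\<Sum>l<N. real (card (?B l) * (card (K l) + 1)) * \<delta>)"
      by (intro sum_mono) simp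
    also have "\<dots> = real n * \<delta>" unfolding n_def of_nat_sum by (rule sum_distrib_right[symmetric])
    finally have "(\<Sum>l<N. a l) < r / 2" using \<delta>(2) by linarith
    then have "suminf a < r" by (intro suminf_half_weights_less[OF a0 a2 _ N])
    then show ?thesis unfolding dstar_def freq_def a_def s_def sum.case .
  qed
  note close = this
  show ?thesis
    by (rule exI[of _ \<delta>], rule exI[of _ \<C>], rule exI[of _ L]) (intro conjI allI impI \<delta>(1) \<C> finitary L close)
qed

section \<open>Good cells and lower Banach density\<close>

context folner_partitions
begin

text \<open>Openness provides a ball around \<mu>, and cells of high level are invariant enough for
  \<open>dstar_small\<close>; this yields the assumption \<open>generic\<close> of the abstract
  argument.\<close>

lemma generic_blocks_in_neighbourhood:
  fixes X :: "('g \<Rightarrow> 'a::{finite,discrete_topology}) set"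
  assumes fin: "\<And>l. finite (K l)" and U: "dstar_open K X \<U>" and \<mu>: "\<mu> \<in> prob_measures X" "Inr \<mu> \<in> \<U>"
  shows "\<exists>\<delta>>0. \<exists>\<C>. finite \<C> \<and> (\<forall>C\<in>\<C>. finitary C) \<and> (\<exists>k0. \<forall>q\<ge>k0. \<forall>x\<in>X. \<forall>g.
      (\<forall>C\<in>\<C>. \<bar>visits x (P q g) C - measure \<mu> (C \<inter> X)\<bar> < \<delta>) \<longrightarrow> Inl (restr x (P q g)) \<in> \<U>)"
proof -
  obtain r where r: "0 < r" "\<And>q. q \<in> blocks_measures X \<Longrightarrow> dstar K X (Inr \<mu>) q < r \<Longrightarrow> q \<in> \<U>"
    using U \<mu>(2) unfolding dstar_open_def by blast
  from dstar_small[of K, OF fin \<mu>(1) r(1)]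
  obtain \<delta> \<C> L where *: "0 < \<delta>" "finite \<C>" "\<forall>C\<in>\<C>. finitary C" "finite L" "L \<noteq> {}"
    and close: "\<forall>x Q. invariant_set L \<delta> Q \<longrightarrow> (\<forall>C\<in>\<C>. \<bar>visits x Q C - measure \<mu> (C \<inter> X)\<bar> < \<delta>) \<longrightarrow>
       dstar K X (Inr \<mu>) (Inl (restr x Q)) < r"
    by (elim exE conjE)
  obtain k0 where k0: "\<And>k g. k \<ge> k0 \<Longrightarrow> invariant_set L \<delta> (P k g)"
    using folner[OF *(4,5,1)] by blast
  have "Inl (restr x (P q g)) \<in> \<U>"
    if "k0 \<le> q" "x \<in> X" "\<forall>C\<in>\<C>. \<bar>visits x (P q g) C - measure \<mu> (C \<inter> X)\<bar> < \<delta>" for q x g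
  proof (rule r(2))
    show "Inl (restr x (P q g)) \<in> blocks_measures X"
      unfolding blocks_measures_def by (intro InlI restr_in_blocks that(2) finite_part part_ne)
    show "dstar K X (Inr \<mu>) (Inl (restr x (P q g))) < r"
      by (rule close[rule_format, OF k0[OF that(1)]]) (use that(3) in blast)
  qed
  note in_\<U> = this
  show ?thesis
    by (rule exI[of _ \<delta>], rule conjI[OF *(1)], rule exI[of _ \<C>], intro conjI *(2,3), rule exI[of _ k0])
      (intro allI ballI impI, rule in_\<U>)
qed

text \<open>One sufficiently invariant \<open>F\<close> is a witness for the supremum. In each
  translate of \<open>F\<close>, the cells lying inside it miss \<open>A\<close> in proportion at
  most \<epsilon>, and the points whose cells stick out make up at most another \<epsilon>.\<close>

lemma lower_banach_density_ge:
  assumes small: "\<And>g. mean (P n g) (\<lambda>h. of_bool (h \<notin> A)) \<le> \<epsilon>" and "0 < \<epsilon>"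
  shows "1 - 2 * \<epsilon> \<le> lower_banach_density A"
proof -
  obtain L where L: "finite L" "\<And>g h. h \<in> P n g \<Longrightarrow> h - g \<in> L" using bounded[of n] by blast
  have L0: "0 \<in> L" using L(2)[OF self_in_part, of 0] by simp
  define \<delta> where "\<delta> = \<epsilon> / (real (card L) + 1)"
  have \<delta>: "0 < \<delta>" "real (card L) * \<delta> \<le> \<epsilon>" using \<open>0 < \<epsilon>\<close> by (auto simp: \<delta>_def field_simps)
  obtain F where F: "invariant_set L \<delta> F"
    using folner[OF L(1) _ \<delta>(1)] L0 by blast
  then have fin: "finite F" "F \<noteq> {}" by (auto simp: invariant_set_def)
  have "1 - 2 * \<epsilon> \<le> real (card (A \<inter> rtrans F g)) / real (card F)" for g
  proof -
    let ?Q = "rtrans F g" and ?I = "{h \<in> rtrans F g. P n h \<subseteq> rtrans F g}"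
    have inv: "invariant_set L \<delta> ?Q" by (rule invariant_set_rtrans[OF F])
    then have Q: "finite ?Q" by (simp add: invariant_set_def)
    \<comment> \<open>The cell of \<open>h\<close> is contained in \<open>rtrans L h\<close>, so the
      \<open>L\<close>-core consists of points whose cells lie inside.\<close>
    have "core L ?Q \<subseteq> ?I"
    proof
      fix h assume h: "h \<in> core L ?Q"
      have "h' \<in> ?Q" if "h' \<in> P n h" for h'
      proof -
        have "(h' - h) + h \<in> rtrans L h" using L(2)[OF that] unfolding rtrans_def by blast
        then show ?thesis using h by (auto simp: core_def)
      qed
      then show "h \<in> ?I" using h by (auto simp: core_def)
    qed
    then have "card (?Q - ?I) \<le> card (?Q - core L ?Q)" using Q by (intro card_mono) auto
    then have outer: "real (card (?Q - ?I)) \<le> \<epsilon> * real (card ?Q)"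
      using Diff_core_small[OF inv L(1) order_refl] mult_right_mono[OF \<delta>(2), of "real (card ?Q)"] by linarith
    have "P n h' \<subseteq> ?I" if "h' \<in> ?I" for h'
      using that part_eq by blast
    then have "(\<Sum>h\<in>?I. of_bool (h \<notin> A)) = (\<Sum>h\<in>?I. mean (P n h) (\<lambda>h. of_bool (h \<notin> A)))"
      using sum_mean[of ?I n "\<lambda>h. of_bool (h \<notin> A)"] Q by simp
    also have "\<dots> \<le> real (card ?I) * \<epsilon>" by (rule sum_bounded_above) (rule small)
    also have "\<dots> \<le> \<epsilon> * real (card ?Q)" using \<open>0 < \<epsilon>\<close> Q by (simp add: card_mono)
    also have "(\<Sum>h\<in>?I. of_bool (h \<notin> A)) = real (card (?I - A))"
      using Q by (simp add: Diff_eq Int_def)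
    finally have inner: "real (card (?I - A)) \<le> \<epsilon> * real (card ?Q)" .
    have "card ?Q \<le> card ((A \<inter> ?Q) \<union> ((?Q - ?I) \<union> (?I - A)))" using Q by (intro card_mono) auto
    also have "\<dots> \<le> card (A \<inter> ?Q) + (card (?Q - ?I) + card (?I - A))"
      by (rule order_trans[OF card_Un_le add_left_mono[OF card_Un_le]])
    finally have "real (card ?Q) \<le> real (card (A \<inter> ?Q) + (card (?Q - ?I) + card (?I - A)))"
      by (rule of_nat_mono)
    then have "real (card ?Q) \<le> real (card (A \<inter> ?Q)) + (real (card (?Q - ?I)) + real (card (?I - A)))"
      by (simp only: of_nat_add)
    then have "(1 - 2 * \<epsilon>) * real (card F) \<le> real (card (A \<inter> ?Q))"
      using inner outer by (simp add: card_rtrans algebra_simps)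
    then show ?thesis using fin by (simp add: pos_le_divide_eq card_gt_0_iff)
  qed
  then have "1 - 2 * \<epsilon> \<le> (INF g. real (card (A \<inter> rtrans F g)) / real (card F))"
    by (intro cINF_greatest) auto
  also have "\<dots> \<le> lower_banach_density A"
    unfolding lower_banach_density_def
  proof (rule cSUP_upper)
    show "F \<in> {F. finite F \<and> F \<noteq> {}}" using fin by simp
    have "(INF g. real (card (A \<inter> rtrans F g)) / real (card F)) \<le> 1" if "finite F" for F
    proof (rule cINF_lower2[of _ _ "0 :: 'g"])
      show "bdd_below (range (\<lambda>g. real (card (A \<inter> rtrans F g)) / real (card F)))"
        by (rule bdd_belowI[of _ 0]) auto
      have "card (A \<inter> rtrans F 0) \<le> card F"
        using card_mono[of "rtrans F 0" "A \<inter> rtrans F 0"] that by (simp add: card_rtrans rtrans_def)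
      then show "real (card (A \<inter> rtrans F 0)) / real (card F) \<le> 1" by (rule real_divide_le_1)
    qed simp
    then show "bdd_above ((\<lambda>F. INF g. real (card (A \<inter> rtrans F g)) / real (card F)) ` {F. finite F \<and> F \<noteq> {}})"
      by (intro bdd_aboveI[of _ 1]) auto
  qed
  finally show ?thesis .
qed

text \<open>Two such cells with a common point \<open>z\<close> lie in one chain of nested cells,
  and both are the highest good cell up to level \<open>n\<close> in that chain.\<close>

lemma maximal_parts_disjoint:
  "disjoint {P k h | k h. k \<in> {m..n} \<and> P k h \<in> \<G> \<and> (\<forall>k'\<in>{k<..n}. P k' h \<notin> \<G>)}" (is "disjoint ?\<Q>")
proof (rule disjointI)
  fix Q Q' assume "Q \<in> ?\<Q>" "Q' \<in> ?\<Q>" "Q \<noteq> Q'"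
  have maximal: "\<exists>k h. R = P k h \<and> k \<le> n \<and> P k h \<in> \<G> \<and> (\<forall>j. k < j \<longrightarrow> j \<le> n \<longrightarrow> P j h \<notin> \<G>)" if "R \<in> ?\<Q>" for R
    using that by fastforce
  obtain k h where Q: "Q = P k h" "k \<le> n" "P k h \<in> \<G>" "\<And>j. k < j \<Longrightarrow> j \<le> n \<Longrightarrow> P j h \<notin> \<G>"
    using maximal[OF \<open>Q \<in> ?\<Q>\<close>] by blast
  obtain k' h' where Q': "Q' = P k' h'" "k' \<le> n" "P k' h' \<in> \<G>" "\<And>j. k' < j \<Longrightarrow> j \<le> n \<Longrightarrow> P j h' \<notin> \<G>"
    using maximal[OF \<open>Q' \<in> ?\<Q>\<close>] by blast
  show "Q \<inter> Q' = {}"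
  proof (rule ccontr)
    assume "Q \<inter> Q' \<noteq> {}"
    then obtain z where z: "z \<in> P k h" "z \<in> P k' h'" using Q(1) Q'(1) by auto
    have "P j h = P j z" if "k \<le> j" for j using part_mono[OF that, of h] z(1) part_eq by blast
    moreover have "P j h' = P j z" if "k' \<le> j" for j using part_mono[OF that, of h'] z(2) part_eq by blast
    ultimately have "k = k'"
      using Q(2-4) Q'(2-4) by (metis less_imp_le linorder_neqE_nat order_refl)
    then show False using \<open>Q \<noteq> Q'\<close> Q(1) Q'(1) z part_eq by metis
  qed
qed

text \<open>Discarding the non-maximal good cells loses no points: a covered point lies in the good
  cell of highest level that contains it.\<close>

lemma Union_maximal_parts:
  "\<Union>{P k h | k h. k \<in> {m..n} \<and> P k h \<in> \<G> \<and> (\<forall>k'\<in>{k<..n}. P k' h \<notin> \<G>)} = {h. \<exists>k\<in>{m..n}. P k h \<in> \<G>}"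
    (is "\<Union>?\<Q> = ?R")
proof
  show "\<Union>?\<Q> \<subseteq> ?R"
  proof
    fix h assume "h \<in> \<Union>?\<Q>"
    then obtain k h' where "h \<in> P k h'" "k \<in> {m..n}" "P k h' \<in> \<G>" by blast
    then show "h \<in> ?R" using part_eq[of h k h'] by (intro CollectI bexI[of _ k]) simp_all
  qed
  show "?R \<subseteq> \<Union>?\<Q>"
  proof
    fix h assume "h \<in> ?R"
    then have ne: "{k\<in>{m..n}. P k h \<in> \<G>} \<noteq> {}" by auto
    define k where "k = Max {k\<in>{m..n}. P k h \<in> \<G>}"
    have k: "k \<in> {k\<in>{m..n}. P k h \<in> \<G>}" unfolding k_def by (rule Max_in) (use ne in auto)
    have max: "j \<le> k" if "j \<in> {m..n}" "P j h \<in> \<G>" for j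
      unfolding k_def by (rule Max_ge) (use that in auto)
    have "P j h \<notin> \<G>" if "j \<in> {k<..n}" for j
      using k that max[of j] by auto
    then have "P k h \<in> ?\<Q>" using k by blast
    then show "h \<in> \<Union>?\<Q>" using self_in_part by blast
  qed
qed

end

section \<open>Covering by good tiles of finitely many levels\<close>

theorem theorem5p5:
  fixes X :: "('g::{group_add,countable} \<Rightarrow> 'a::{finite,discrete_topology}) set"
    and K :: "nat \<Rightarrow> 'g set"
    and S :: "nat \<Rightarrow> 'g set list"
    and TT :: "nat \<Rightarrow> 'g tiling set"
    and W :: "(nat \<Rightarrow> 'g tiling) set"
    and \<U> :: "('g, 'a) block_or_measure set"
    and m :: nat and \<epsilon> :: real
  assumes "infinite (UNIV :: 'g set)"
    and "amenable TYPE('g)"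
    and "subshift X"
    and "tiling_system S TT W"
    and "folner_system S"
    and "deterministic_system S W"
    and "bij_betw K UNIV {F. finite F}"
    and "dstar_open K X \<U>"
    and "Inr ` ergodic_measures X \<subseteq> \<U>"
    and "\<epsilon> > 0"
  shows "\<exists>n\<ge>m. \<forall>x\<in>X. \<exists>\<Q>.
           disjoint \<Q> \<and>
           (\<forall>Q\<in>\<Q>. (\<exists>k\<in>{m..n}. \<exists>F\<in>set (S k). \<exists>c. Q = rtrans F c) \<and> Inl (restr x Q) \<in> \<U>) \<and>
           lower_banach_density (\<Union>\<Q>) \<ge> 1 - \<epsilon>"
proof (cases "X = {}")
  case True
  \<comment> \<open>There is no \<open>x\<close> to treat; the case is separate because states exist
    only over a nonempty \<open>X\<close>.\<close>
  then show ?thesis by auto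
next
  case False
  \<comment> \<open>The same point of the tiling system is used for every \<open>x\<close>, so a
    level \<open>n\<close> depending on it is still uniform in \<open>x\<close>.\<close>
  obtain T where T: "T \<in> W" using assms(4) unfolding tiling_system_def by blast
  have cong: "congruent_system S W" using assms(6) by (simp add: deterministic_system_def)
  have tiling: "is_tiling (S k) (T k)" for k by (rule tiling_system_tiling[OF assms(4) T])
  have fin: "finite (K l)" for l using assms(7) unfolding bij_betw_def by blast
  interpret folner_partitions "tile_at S T"
    by (rule folner_partitions_tile_at[OF assms(4,5) cong T])
  \<comment> \<open>The indicator that no tile of levels \<open>m\<close> to \<open>n\<close>
    containing \<open>h\<close> is good. It decreases in \<open>n\<close>, and it equals 1 when
    \<open>n < m\<close>, which is why \<open>vanish\<close> below starts at
    \<open>max m k0\<close>.\<close>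
  let ?u = "\<lambda>x n h. of_bool (\<forall>k\<in>{m..n}. Inl (restr x (tile_at S T k h)) \<notin> \<U>) :: real"
  interpret uncovered_proportion "tile_at S T" X ?u
  proof
    show "X \<noteq> {}" by (rule False)
    show "subshift X" by (rule assms(3))
    show "?u x n h \<le> ?u x q h" if "q \<le> n" for x q n h using that by auto
    fix \<mu> assume \<mu>: "\<mu> \<in> ergodic_measures X"
    then have "\<mu> \<in> prob_measures X" "Inr \<mu> \<in> \<U>"
      using assms(9) by (auto simp: ergodic_measures_def invariant_measures_def)
    from generic_blocks_in_neighbourhood[of K, OF fin assms(8) this]
    obtain \<delta> \<C> k0 where *: "0 < \<delta>" "finite \<C>" "\<forall>C\<in>\<C>. finitary C"
      "\<forall>q\<ge>k0. \<forall>x\<in>X. \<forall>g. (\<forall>C\<in>\<C>. \<bar>visits x (tile_at S T q g) C - measure \<mu> (C \<inter> X)\<bar> < \<delta>) \<longrightarrow>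
        Inl (restr x (tile_at S T q g)) \<in> \<U>" by blast
    have vanish: "?u x q h = 0"
      if "max m k0 \<le> q" "x \<in> X" "\<forall>C\<in>\<C>. \<bar>visits x (tile_at S T q g) C - measure \<mu> (C \<inter> X)\<bar> < \<delta>"
        "h \<in> tile_at S T q g" for q x g h
    proof -
      have "Inl (restr x (tile_at S T q g)) \<in> \<U>" using *(4) that(1-3) by simp
      then have "Inl (restr x (tile_at S T q h)) \<in> \<U>" by (simp only: part_eq[OF that(4)])
      moreover have "q \<in> {m..q}" using that(1) by simp
      ultimately show ?thesis by (subst of_bool_eq_0_iff) blast
    qed
    show "\<exists>\<delta>>0. \<exists>\<C>. finite \<C> \<and> (\<forall>C\<in>\<C>. finitary C) \<and> (\<exists>k0. \<forall>q\<ge>k0. \<forall>x\<in>X. \<forall>g.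
        (\<forall>C\<in>\<C>. \<bar>visits x (tile_at S T q g) C - measure \<mu> (C \<inter> X)\<bar> < \<delta>) \<longrightarrow>
        (\<forall>h\<in>tile_at S T q g. ?u x q h = 0))"
    proof (intro exI conjI allI ballI impI)
      show "0 < \<delta>" "finite \<C>" by (rule *(1,2))+
      show "finitary C" if "C \<in> \<C>" for C using *(3) that by (rule bspec)
    qed (rule vanish)
  qed auto
  \<comment> \<open>Half of \<epsilon>, since \<open>lower_banach_density_ge\<close> doubles the
    loss.\<close>
  have "0 < \<epsilon> / 2" using assms(10) by simp
  then obtain n where n: "n \<ge> m" "\<And>x g. x \<in> X \<Longrightarrow> mean (tile_at S T n g) (?u x n) < \<epsilon> / 2"
    using uncovered_proportion_small[of "\<epsilon> / 2" m] by blast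
  have "\<exists>\<Q>. disjoint \<Q> \<and>
      (\<forall>Q\<in>\<Q>. (\<exists>k\<in>{m..n}. \<exists>F\<in>set (S k). \<exists>c. Q = rtrans F c) \<and> Inl (restr x Q) \<in> \<U>) \<and>
      lower_banach_density (\<Union>\<Q>) \<ge> 1 - \<epsilon>" if "x \<in> X" for x
  proof -
    let ?\<G> = "{Q. Inl (restr x Q) \<in> \<U>}"
    let ?\<Q> = "{tile_at S T k h | k h. k \<in> {m..n} \<and> tile_at S T k h \<in> ?\<G> \<and>
      (\<forall>k'\<in>{k<..n}. tile_at S T k' h \<notin> ?\<G>)}"
    have "\<exists>F\<in>set (S k). \<exists>c. tile_at S T k h = rtrans F c" for k h
      by (rule tilesE[OF tiling[of k] tile_at(1)[of S k T h, OF tiling]]) blast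
    then have shapes: "\<forall>Q\<in>?\<Q>. (\<exists>k\<in>{m..n}. \<exists>F\<in>set (S k). \<exists>c. Q = rtrans F c) \<and> Inl (restr x Q) \<in> \<U>"
      by blast
    have "mean (tile_at S T n g) (\<lambda>h. of_bool (h \<notin> \<Union>?\<Q>)) \<le> \<epsilon> / 2" for g
      using n(2)[OF that, of g] unfolding Union_maximal_parts by (simp add: less_imp_le)
    then have "1 - 2 * (\<epsilon> / 2) \<le> lower_banach_density (\<Union>?\<Q>)"
      using \<open>0 < \<epsilon> / 2\<close> by (rule lower_banach_density_ge)
    moreover have "2 * (\<epsilon> / 2) = \<epsilon>" by simp
    ultimately have density: "1 - \<epsilon> \<le> lower_banach_density (\<Union>?\<Q>)" by (simp only:)
    show ?thesis by (rule exI[of _ ?\<Q>]) (intro conjI maximal_parts_disjoint shapes density)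
  qed
  note covering = this
  show ?thesis by (rule exI[of _ n]) (intro conjI ballI n(1) covering)
qed

end
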